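(* Let $w_0,\dots,w_n$ be positive integers, $s=w_0+\cdots+w_n$, and let $T_w-q$ be the differential operator $\prod_{i=0}^n (w_i\hbar\partial)(w_i\hbar\partial-\hbar)\cdots(w_i\hbar\partial-(w_i-1)\hbar)-q$, where $\partial=q\frac{d}{dq}$. Let $\mathcal{M}=D^\hbar/(T_w-q)$, let $\bar{\mathcal{M}}^*$ be its sign-reversed dual $D^\hbar$-module with action $\odot$, and let $\delta_0,\dots,\delta_{s-1}$ be the basis of $\bar{\mathcal{M}}^*$ dual to the basis $1,\hbar\partial,\dots,(\hbar\partial)^{s-1}$ of $\mathcal{M}$. Then: (1) $\delta_n$ is a cyclic element of $\bar{\mathcal{M}}^*$, that is, $D^\hbar\odot\delta_n=\bar{\mathcal{M}}^*$. (2) $(T_w-q)\odot\delta_n=0$. (3) The map $\mathcal{M}\to\bar{\mathcal{M}}^*$, $[P]\mapsto P\odot\delta_n$, is an isomorphism of $D^\hbar$-modules.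
   Context: Let $l$ be the lowest common multiple of $w_0,\dots,w_n$. The coefficient ring $\mathcal{F}$ is the ring of functions of $(q,\hbar)$ which are polynomial in $q^{\pm 1/l}$ and holomorphic in $\hbar$ in a neighbourhood of $\hbar=0$. $D^\hbar$ is the ring of ordinary differential operators generated over $\mathcal{F}$ by $\hbar\partial$, where $\partial=q\frac{d}{dq}$ (so $\hbar\partial\, f=f\,\hbar\partial+\hbar\, q\frac{\partial f}{\partial q}$ for $f\in\mathcal{F}$). $(T_w-q)$ denotes the left ideal of $D^\hbar$ generated by $T_w-q$. The $D^\hbar$-module $\mathcal{M}=D^\hbar/(T_w-q)$ is free of rank $s$ over $\mathcal{F}$ with basis (the classes of) $1,\hbar\partial,\dots,(\hbar\partial)^{s-1}$. The dual module $\mathcal{M}^*$ is the space of $\mathcal{F}$-module homomorphisms $\pi:\mathcal{M}\to\mathcal{F}$, with $\mathcal{F}$ acting by multiplication and with $D^\hbar$-module structure determined by $(\partial\cdot\pi)(P)=-\pi(\partial\cdot P)+q\frac{\partial}{\partial q}\pi(P)$, i.e. $(\hbar\partial\cdot\pi)(P)=-\pi(\hbar\partial\cdot P)+\hbar q\frac{\partial}{\partial q}\pi(P)$. The $D^\hbar$-module $\bar{\mathcal{M}}^*$ is obtained from $\mathcal{M}^*$ by reversing the sign in the action of $\hbar$: $\bar{\mathcal{M}}^*=\mathcal{M}^*$ as a set (and with the same notion of basis over $\mathcal{F}$), but the action, denoted $\odot$, is the one derived from $\hbar\odot\pi=-\hbar\pi$, $\partial\odot\pi=\partial\cdot\pi$.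 Thus $f(q,\hbar)\odot\pi=f(q,-\hbar)\,\pi$ for $f\in\mathcal{F}$, and $(\hbar\partial\odot\pi)(P)=\pi(\hbar\partial\cdot P)-\hbar q\frac{\partial}{\partial q}\pi(P)$. *)

theory Defs
  imports
    "HOL-Analysis.Complex_Analysis_Basics"
    "HOL-Library.Poly_Mapping"
    "HOL-Algebra.Generated_Rings"
    "HOL-Algebra.AbelCoset"
    "HOL-Algebra.Module"
begin

section \<open>Functions of \<open>\<hbar>\<close> holomorphic in a neighbourhood of \<open>\<hbar> = 0\<close>\<close>

text \<open>
  The neighbourhood may depend on the function, so such functions form a ring only after
  identifying two of them when they agree near \<open>0\<close>: the ring of holomorphic germs.
\<close>

definition germ_rel :: "(complex \<Rightarrow> complex) \<Rightarrow> (complex \<Rightarrow> complex) \<Rightarrow> bool" where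
  "germ_rel f g \<longleftrightarrow> f analytic_on {0} \<and> g analytic_on {0} \<and> (\<forall>\<^sub>F h in nhds 0. f h = g h)"

quotient_type hol_germ = "complex \<Rightarrow> complex" / partial: germ_rel
proof (rule part_equivpI)
  show "\<exists>f. germ_rel f f"
    by (intro exI[of _ "\<lambda>_. 0"]) (simp add: germ_rel_def)
  show "symp germ_rel"
    by (auto simp: symp_def germ_rel_def eq_commute)
  show "transp germ_rel"
    unfolding transp_def germ_rel_def by (auto elim: eventually_elim2)
qed

instantiation hol_germ :: comm_ring_1
begin

lift_definition zero_hol_germ :: hol_germ is "\<lambda>_. 0"
  by (simp add: germ_rel_def)

lift_definition one_hol_germ :: hol_germ is "\<lambda>_. 1"
  by (simp add: germ_rel_def)

lift_definition plus_hol_germ :: "hol_germ \<Rightarrow> hol_germ \<Rightarrow> hol_germ" is "\<lambda>f g h. f h + g h"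
  unfolding germ_rel_def by (auto intro: analytic_intros elim: eventually_elim2)

lift_definition minus_hol_germ :: "hol_germ \<Rightarrow> hol_germ \<Rightarrow> hol_germ" is "\<lambda>f g h. f h - g h"
  unfolding germ_rel_def by (auto intro: analytic_intros elim: eventually_elim2)

lift_definition times_hol_germ :: "hol_germ \<Rightarrow> hol_germ \<Rightarrow> hol_germ" is "\<lambda>f g h. f h * g h"
  unfolding germ_rel_def by (auto intro: analytic_intros elim: eventually_elim2)

lift_definition uminus_hol_germ :: "hol_germ \<Rightarrow> hol_germ" is "\<lambda>f h. - f h"
  unfolding germ_rel_def by (auto intro: analytic_intros elim: eventually_mono)

instance
proof
  show "(0 :: hol_germ) \<noteq> 1"
    by transfer (simp add: germ_rel_def)
qed (transfer; auto simp: germ_rel_def algebra_simps intro!: analytic_intros)+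

end

lift_definition germ_const :: "complex \<Rightarrow> hol_germ" is "\<lambda>c _. c"
  by (simp add: germ_rel_def)

lift_definition germ_hbar :: hol_germ is "\<lambda>h. h"
  by (simp add: germ_rel_def)

lemma uminus_analytic: "(uminus :: complex \<Rightarrow> complex) analytic_on S"
  using analytic_on_neg[OF analytic_on_ident, of S] by simp

lemma analytic_reflect:
  fixes k :: "complex \<Rightarrow> complex"
  shows "k analytic_on {0} \<Longrightarrow> (\<lambda>h. k (- h)) analytic_on {0}"
  using analytic_on_compose_gen[of uminus "{0}" k "{0}"]
  by (simp add: o_def uminus_analytic)

lift_definition germ_reflect :: "hol_germ \<Rightarrow> hol_germ" is "\<lambda>f h. f (- h)"
proof -
  fix f g assume *: "germ_rel f g"
  have "filterlim uminus (nhds 0) (nhds (0 :: complex))"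
    using tendsto_minus[OF filterlim_ident, of "0 :: complex"] by simp
  with * have "\<forall>\<^sub>F h in nhds 0. f (- h) = g (- h)"
    unfolding germ_rel_def filterlim_iff by blast
  with * show "germ_rel (\<lambda>h. f (- h)) (\<lambda>h. g (- h))"
    by (simp add: germ_rel_def analytic_reflect)
qed

section \<open>The coefficient ring \<open>\<F>\<close>\<close>

text \<open>
  An element of \<open>\<F>\<close> is a finite sum of terms \<open>a\<^sub>k(\<hbar>) q\<^bsup>k/l\<^esup>\<close> with \<open>k\<close> an integer; it is
  represented by \<open>k \<mapsto> a\<^sub>k\<close>, with the convolution product of \<open>Poly_Mapping\<close>.  The index is the
  exponent of \<open>q\<^bsup>1/l\<^esup>\<close>, so that \<open>l\<close> enters only through \<open>q\<close> itself (index \<open>l\<close>) and through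
  \<open>\<partial> = q d/dq\<close>, which multiplies \<open>q\<^bsup>k/l\<^esup>\<close> by \<open>k/l\<close>.
\<close>

type_synonym coeff = "int \<Rightarrow>\<^sub>0 hol_germ"

definition hbar :: coeff where
  "hbar = Poly_Mapping.single 0 germ_hbar"

definition qvar :: "nat \<Rightarrow> coeff" where
  "qvar l = Poly_Mapping.single (int l) 1"

definition q_ddq :: "nat \<Rightarrow> coeff \<Rightarrow> coeff" where
  "q_ddq l = Poly_Mapping.mapp (\<lambda>k a. germ_const (of_int k / of_nat l) * a)"

definition hbar_reflect :: "coeff \<Rightarrow> coeff" where \<comment> \<open>\<open>f(q, \<hbar>) \<mapsto> f(q, -\<hbar>)\<close>\<close>
  "hbar_reflect = Poly_Mapping.map germ_reflect"

lemma germ_reflect_zero [simp]: "germ_reflect 0 = 0"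
  by transfer (simp add: germ_rel_def)

lemma germ_reflect_one [simp]: "germ_reflect 1 = 1"
  by transfer (simp add: germ_rel_def)

lemma germ_reflect_const [simp]: "germ_reflect (germ_const c) = germ_const c"
  by transfer (simp add: germ_rel_def)

lemma germ_reflect_hbar [simp]: "germ_reflect germ_hbar = - germ_hbar"
  by transfer (simp add: germ_rel_def uminus_analytic)

lemma germ_reflect_add [simp]: "germ_reflect (a + b) = germ_reflect a + germ_reflect b"
  by transfer (auto simp: germ_rel_def intro!: analytic_intros analytic_reflect)

lemma germ_reflect_mult [simp]: "germ_reflect (a * b) = germ_reflect a * germ_reflect b"
  by transfer (auto simp: germ_rel_def intro!: analytic_intros analytic_reflect)

lemma germ_reflect_uminus [simp]: "germ_reflect (- a) = - germ_reflect a"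
  by transfer (auto simp: germ_rel_def intro!: analytic_intros analytic_reflect)

lemma germ_reflect_reflect [simp]: "germ_reflect (germ_reflect a) = a"
  by transfer (auto simp: germ_rel_def)

lemma lookup_hbar_reflect:
  "Poly_Mapping.lookup (hbar_reflect f) k = germ_reflect (Poly_Mapping.lookup f k)"
  by (simp add: hbar_reflect_def map.rep_eq when_def)

lemma hbar_reflect_single:
  "hbar_reflect (Poly_Mapping.single k a) = Poly_Mapping.single k (germ_reflect a)"
  by (rule poly_mapping_eqI) (simp add: lookup_hbar_reflect lookup_single when_def)

lemma hbar_reflect_add: "hbar_reflect (f + g) = hbar_reflect f + hbar_reflect g"
  by (rule poly_mapping_eqI) (simp add: lookup_hbar_reflect lookup_add)

lemma hbar_reflect_uminus: "hbar_reflect (- f) = - hbar_reflect f"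
  by (rule poly_mapping_eqI) (simp add: lookup_hbar_reflect)

lemma hbar_reflect_reflect [simp]: "hbar_reflect (hbar_reflect f) = f"
  by (rule poly_mapping_eqI) (simp add: lookup_hbar_reflect)

lemma hbar_reflect_hbar: "hbar_reflect hbar = - hbar"
  by (simp add: hbar_def hbar_reflect_single single_uminus)

lemma coeff_induct [case_names single add]:
  fixes f :: coeff
  assumes "\<And>k a. P (Poly_Mapping.single k a)" "\<And>f g. P f \<Longrightarrow> P g \<Longrightarrow> P (f + g)"
  shows "P f"
proof (induction f rule: update_induct)
  case const
  then show ?case using assms(1)[of 0 0] by simp
next
  case (update f k a)
  have "Poly_Mapping.update k a f = Poly_Mapping.single k a + f"
    using update(1) by (intro poly_mapping_eqI)
      (auto simp: lookup_update lookup_add lookup_single when_def in_keys_iff)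
  then show ?case using assms update by simp
qed

lemma hbar_reflect_mult: "hbar_reflect (f * g) = hbar_reflect f * hbar_reflect g"
proof (induction f rule: coeff_induct)
  case (single k a)
  show ?case
    by (induction g rule: coeff_induct)
      (simp_all add: hbar_reflect_single mult_single hbar_reflect_add distrib_left)
qed (simp add: hbar_reflect_add distrib_right)

lemma lookup_q_ddq:
  "Poly_Mapping.lookup (q_ddq l f) k = germ_const (of_int k / of_nat l) * Poly_Mapping.lookup f k"
  by (simp add: q_ddq_def lookup_mapp when_def in_keys_iff)

lemma q_ddq_hbar_reflect: "q_ddq l (hbar_reflect f) = hbar_reflect (q_ddq l f)"
  by (rule poly_mapping_eqI) (simp add: lookup_hbar_reflect lookup_q_ddq)

section \<open>The ring \<open>D\<^sup>\<hbar>\<close> of differential operators\<close>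

definition additive_End :: "(coeff \<Rightarrow> coeff) ring" where
  "additive_End = \<lparr>carrier = {\<phi>. additive \<phi>}, mult = (\<circ>), one = id,
     zero = (\<lambda>_. 0), add = (\<lambda>\<phi> \<psi> f. \<phi> f + \<psi> f)\<rparr>"

definition mult_op :: "coeff \<Rightarrow> coeff \<Rightarrow> coeff" where
  "mult_op f = (\<lambda>g. f * g)"

definition hbar_d :: "nat \<Rightarrow> coeff \<Rightarrow> coeff" where
  "hbar_d l = (\<lambda>f. hbar * q_ddq l f)"

text \<open>
  Operators are identified with the maps they induce on \<open>\<F>\<close>.  Nothing is lost: an operator
  \<open>\<Sum> f\<^sub>i (\<hbar>\<partial>)\<^sup>i\<close> acts on \<open>q\<^bsup>k/l\<^esup>\<close> as multiplication by \<open>\<Sum> f\<^sub>i (\<hbar>k/l)\<^sup>i\<close>, and these values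
  for all \<open>k\<close> determine the \<open>f\<^sub>i\<close>.
\<close>

definition diff_op_ring :: "nat \<Rightarrow> (coeff \<Rightarrow> coeff) ring" where
  "diff_op_ring l = additive_End
     \<lparr>carrier := generate_ring additive_End (insert (hbar_d l) (range mult_op))\<rparr>"

text \<open>
  All factors of \<open>T\<^sub>w\<close> commute, so the order chosen in the iterated composition is immaterial.
\<close>

definition T_factor :: "nat \<Rightarrow> nat \<Rightarrow> nat \<Rightarrow> coeff \<Rightarrow> coeff" where
  "T_factor l m k = (\<lambda>f. of_nat m * hbar_d l f - of_nat k * hbar * f)"

definition T_op :: "nat \<Rightarrow> nat \<Rightarrow> (nat \<Rightarrow> nat) \<Rightarrow> coeff \<Rightarrow> coeff" where
  "T_op l n w = foldr (\<circ>)
     (concat (map (\<lambda>i. map (\<lambda>k. T_factor l (w i) k) [0..<w i]) [0..<Suc n])) id"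

definition T_minus_q :: "nat \<Rightarrow> nat \<Rightarrow> (nat \<Rightarrow> nat) \<Rightarrow> coeff \<Rightarrow> coeff" where
  "T_minus_q l n w = (\<lambda>f. T_op l n w f - qvar l * f)"

section \<open>Left modules over a not necessarily commutative ring\<close>

locale left_module = R?: ring R + M?: abelian_group M
  for R :: "('a, 'c) ring_scheme" (structure)
  and M :: "('a, 'b, 'd) module_scheme" (structure) +
  assumes smult_closed:
      "\<lbrakk>a \<in> carrier R; x \<in> carrier M\<rbrakk> \<Longrightarrow> a \<odot>\<^bsub>M\<^esub> x \<in> carrier M"
    and smult_l_distr:
      "\<lbrakk>a \<in> carrier R; b \<in> carrier R; x \<in> carrier M\<rbrakk> \<Longrightarrow>
       (a \<oplus>\<^bsub>R\<^esub> b) \<odot>\<^bsub>M\<^esub> x = a \<odot>\<^bsub>M\<^esub> x \<oplus>\<^bsub>M\<^esub> b \<odot>\<^bsub>M\<^esub> x"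
    and smult_r_distr:
      "\<lbrakk>a \<in> carrier R; x \<in> carrier M; y \<in> carrier M\<rbrakk> \<Longrightarrow>
       a \<odot>\<^bsub>M\<^esub> (x \<oplus>\<^bsub>M\<^esub> y) = a \<odot>\<^bsub>M\<^esub> x \<oplus>\<^bsub>M\<^esub> a \<odot>\<^bsub>M\<^esub> y"
    and smult_assoc:
      "\<lbrakk>a \<in> carrier R; b \<in> carrier R; x \<in> carrier M\<rbrakk> \<Longrightarrow>
       (a \<otimes>\<^bsub>R\<^esub> b) \<odot>\<^bsub>M\<^esub> x = a \<odot>\<^bsub>M\<^esub> (b \<odot>\<^bsub>M\<^esub> x)"
    and smult_one:
      "x \<in> carrier M \<Longrightarrow> \<one>\<^bsub>R\<^esub> \<odot>\<^bsub>M\<^esub> x = x"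

definition left_module_iso ::
  "('a, 'c) ring_scheme \<Rightarrow> ('a, 'b, 'd) module_scheme \<Rightarrow> ('a, 'e, 'f) module_scheme
     \<Rightarrow> ('b \<Rightarrow> 'e) \<Rightarrow> bool" where
  "left_module_iso R M N h \<longleftrightarrow>
     left_module R M \<and> left_module R N \<and>
     bij_betw h (carrier M) (carrier N) \<and>
     (\<forall>x\<in>carrier M. \<forall>y\<in>carrier M. h (x \<oplus>\<^bsub>M\<^esub> y) = h x \<oplus>\<^bsub>N\<^esub> h y) \<and>
     (\<forall>a\<in>carrier R. \<forall>x\<in>carrier M. h (a \<odot>\<^bsub>M\<^esub> x) = a \<odot>\<^bsub>N\<^esub> h x)"

definition left_ideal_gen :: "('a, 'c) ring_scheme \<Rightarrow> 'a \<Rightarrow> 'a set" where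
  "left_ideal_gen R a = (\<lambda>x. x \<otimes>\<^bsub>R\<^esub> a) ` carrier R"

text \<open>
  In the quotient \<open>R/I\<close> by a left ideal and in the duals below, the ring multiplication fields
  of the record type \<open>module\<close> play no role.
\<close>

definition quot_module :: "('a, 'c) ring_scheme \<Rightarrow> 'a set \<Rightarrow> ('a, 'a set) module" where
  "quot_module R I = \<lparr>carrier = a_rcosets\<^bsub>R\<^esub> I, mult = undefined, one = undefined,
     zero = I, add = set_add R,
     smult = (\<lambda>a X. \<Union>x\<in>X. I +>\<^bsub>R\<^esub> (a \<otimes>\<^bsub>R\<^esub> x))\<rparr>"

section \<open>The dual module and its sign reversal\<close>

type_synonym 'b coeff_module = "(coeff \<Rightarrow> coeff, 'b) module"

text \<open>The \<open>\<F>\<close>-linear maps \<open>M \<rightarrow> \<F>\<close>; values outside the carrier of \<open>M\<close> are normalised.\<close>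

definition dual_set :: "'b coeff_module \<Rightarrow> ('b \<Rightarrow> coeff) set" where
  "dual_set M = {\<pi> \<in> extensional (carrier M).
     (\<forall>X\<in>carrier M. \<forall>Y\<in>carrier M. \<pi> (X \<oplus>\<^bsub>M\<^esub> Y) = \<pi> X + \<pi> Y) \<and>
     (\<forall>f. \<forall>X\<in>carrier M. \<pi> (mult_op f \<odot>\<^bsub>M\<^esub> X) = f * \<pi> X)}"

definition dual_module_with ::
  "'b coeff_module \<Rightarrow> ((coeff \<Rightarrow> coeff) \<Rightarrow> ('b \<Rightarrow> coeff) \<Rightarrow> ('b \<Rightarrow> coeff)) \<Rightarrow> ('b \<Rightarrow> coeff) coeff_module"
where
  "dual_module_with M act = \<lparr>carrier = dual_set M, mult = undefined, one = undefined,
     zero = (\<lambda>X\<in>carrier M. 0), add = (\<lambda>\<pi> \<rho>. \<lambda>X\<in>carrier M. \<pi> X + \<rho> X),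
     smult = act\<rparr>"

definition is_dual_action ::
  "nat \<Rightarrow> 'b coeff_module \<Rightarrow> ((coeff \<Rightarrow> coeff) \<Rightarrow> ('b \<Rightarrow> coeff) \<Rightarrow> ('b \<Rightarrow> coeff)) \<Rightarrow> bool" where
  "is_dual_action l M act \<longleftrightarrow>
     act \<in> carrier (diff_op_ring l) \<rightarrow>\<^sub>E (dual_set M \<rightarrow>\<^sub>E dual_set M) \<and>
     left_module (diff_op_ring l) (dual_module_with M act) \<and>
     (\<forall>f. \<forall>\<pi>\<in>dual_set M. act (mult_op f) \<pi> = (\<lambda>X\<in>carrier M. f * \<pi> X)) \<and>
     (\<forall>\<pi>\<in>dual_set M. act (hbar_d l) \<pi> =
        (\<lambda>X\<in>carrier M. - \<pi> (hbar_d l \<odot>\<^bsub>M\<^esub> X) + hbar * q_ddq l (\<pi> X)))"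

text \<open>
  The action is unique because \<open>D\<^sup>\<hbar>\<close> is generated by \<open>\<F>\<close> and \<open>\<hbar>\<partial>\<close>; it exists because the
  two prescribed operations satisfy \<open>\<hbar>\<partial> f = f \<hbar>\<partial> + \<hbar> q \<partial>f/\<partial>q\<close>.
\<close>

definition dual_module :: "nat \<Rightarrow> 'b coeff_module \<Rightarrow> ('b \<Rightarrow> coeff) coeff_module" where
  "dual_module l M = dual_module_with M (THE act. is_dual_action l M act)"

text \<open>
  Replacing \<open>\<hbar>\<close> by \<open>-\<hbar>\<close> in an operator \<open>P(q, \<hbar>, \<partial>)\<close> amounts to conjugating with the
  substitution \<open>f(q, \<hbar>) \<mapsto> f(q, -\<hbar>)\<close> of \<open>\<F>\<close>; the two lemmas show the effect on generators.
\<close>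

definition sign_reverse :: "(coeff \<Rightarrow> coeff) \<Rightarrow> (coeff \<Rightarrow> coeff)" where
  "sign_reverse P = hbar_reflect \<circ> P \<circ> hbar_reflect"

lemma sign_reverse_mult_op: "sign_reverse (mult_op f) = mult_op (hbar_reflect f)"
  by (rule ext) (simp add: sign_reverse_def mult_op_def hbar_reflect_mult)

lemma sign_reverse_hbar_d: "sign_reverse (hbar_d l) f = - hbar_d l f"
  by (simp add: sign_reverse_def hbar_d_def hbar_reflect_mult q_ddq_hbar_reflect hbar_reflect_hbar)

definition sign_reversed_dual :: "nat \<Rightarrow> 'b coeff_module \<Rightarrow> ('b \<Rightarrow> coeff) coeff_module" where
  "sign_reversed_dual l M =
     (dual_module l M)\<lparr>smult := (\<lambda>P \<pi>. sign_reverse P \<odot>\<^bsub>dual_module l M\<^esub> \<pi>)\<rparr>"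

definition dual_basis :: "'b coeff_module \<Rightarrow> nat \<Rightarrow> (nat \<Rightarrow> 'b) \<Rightarrow> nat \<Rightarrow> ('b \<Rightarrow> coeff)" where
  "dual_basis M s b i = (THE \<pi>. \<pi> \<in> dual_set M \<and> (\<forall>j<s. \<pi> (b j) = (if j = i then 1 else 0)))"

end

theory Submission
  imports Defs "HOL-Computational_Algebra.Polynomial" "HOL-Library.Function_Algebras"
begin

text \<open>
  Write \<open>x\<close> for \<open>\<hbar>\<partial>\<close>.  Every operator has a unique normal form \<open>\<Sum> f\<^sub>i x\<^sup>i\<close>, so \<open>D\<^sup>\<hbar>\<close> is identified
  (\<open>diff_op_inj\<close>, \<open>carrier_diff_op_ring\<close>) with polynomials over \<open>\<F>\<close> under the twisted product
  determined by \<open>x f = f x + \<hbar>\<partial>f\<close>.  The leading coefficient \<open>C = \<Prod> w\<^sub>i ^ w\<^sub>i\<close> of \<open>T\<^sub>w - q\<close> is a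
  unit, so remainders modulo \<open>T\<^sub>w - q\<close> exist and \<open>\<M>\<close> is free on \<open>1, x, \<dots>, x\<^bsup>s-1\<^esup>\<close>.
  
  A functional \<open>\<pi>\<close> in the dual is determined by the sequence of its values \<open>\<pi>(x\<^sup>k)\<close>, for all
  \<open>k\<close>.  In these terms the sign-reversed action of \<open>x\<close> is \<open>\<psi>\<^sub>k \<mapsto> \<psi>\<^bsub>k+1\<^esub> - \<hbar>\<partial>\<psi>\<^sub>k\<close>, and \<open>f\<close> acts as
  multiplication by \<open>f(q, -\<hbar>)\<close>.  Everything is computed with such sequences.
  
  Factoring out of \<open>T\<^sub>w\<close> the \<open>n + 1\<close> factors \<open>w\<^sub>i x\<close> gives \<open>T\<^sub>w = P x\<^bsup>n+1\<^esup>\<close>, and \<open>T\<^sub>w\<close> has no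
  coefficient in degrees \<open>\<le> n\<close>.  Reading off \<open>\<delta>\<^sub>i(x\<^sup>s)\<close> from \<open>T\<^sub>w - q\<close> one finds
  \<open>x \<odot> \<delta>\<^sub>i = \<delta>\<^bsub>i-1\<^esub>\<close> for \<open>1 \<le> i \<le> n\<close>, \<open>x \<odot> \<delta>\<^sub>0 = C\<^bsup>-1\<^esup> q \<delta>\<^bsub>s-1\<^esub>\<close>, and, for \<open>i > n\<close>,
  \<open>x \<odot> \<delta>\<^sub>i = \<delta>\<^bsub>i-1\<^esub>\<close> minus a multiple of \<open>\<delta>\<^bsub>s-1\<^esub>\<close> by a coefficient of \<open>P\<close>.  Applying powers of \<open>x\<close>
  to \<open>\<delta>\<^sub>n\<close> thus runs through \<open>\<delta>\<^sub>n, \<dots>, \<delta>\<^sub>0\<close>, then, \<open>q\<close> being a unit, reaches \<open>\<delta>\<^bsub>s-1\<^esub>\<close>, and from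
  there descends back to \<open>\<delta>\<^bsub>n+1\<^esub>\<close>.  Hence \<open>\<delta>\<^sub>n\<close> is cyclic (\<open>dual_seq_cyclic\<close>), and since the
  passage from \<open>(\<delta>\<^sub>i)\<close> to \<open>(x\<^sup>j \<odot> \<delta>\<^sub>n)\<close> is triangular with unit diagonal, no nonzero operator of degree
  \<open>< s\<close> kills \<open>\<delta>\<^sub>n\<close> (\<open>ev_dual_seq_inj\<close>).
  
  That \<open>T\<^sub>w - q\<close> itself kills \<open>\<delta>\<^sub>n\<close> (\<open>annihilates_dual_seq\<close>) is where the sign reversal matters.
  Telescoping the relations for \<open>i > n\<close> by Horner's rule gives \<open>P(x, \<hbar>) \<delta>\<^bsub>s-1\<^esub> = C \<delta>\<^sub>n\<close>, where \<open>\<hbar>\<close>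
  stands for plain multiplication, that is, for the action of \<open>-\<hbar>\<close>.  On the other hand
  \<open>T\<^sub>w \<odot> \<delta>\<^sub>n = P x\<^bsup>n+1\<^esup> \<odot> \<delta>\<^sub>n = P \<odot> C\<^bsup>-1\<^esup> q \<delta>\<^bsub>s-1\<^esub>\<close>, and moving \<open>q\<close> to the left replaces \<open>x\<close> by
  \<open>x + \<hbar>\<close>.  The two fit together because \<open>P(x + \<hbar>, \<hbar>) = P(x, -\<hbar>)\<close>: the first substitution turns the
  factor \<open>w\<^sub>i x - k\<hbar>\<close> of \<open>P\<close>, where \<open>0 < k < w\<^sub>i\<close>, into \<open>w\<^sub>i x + (w\<^sub>i - k)\<hbar>\<close>, the second into
  \<open>w\<^sub>i x + k\<hbar>\<close>, and \<open>k \<mapsto> w\<^sub>i - k\<close> matches the two families (\<open>reduced_poly_reflect\<close>).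
  
  So the annihilator of the generator \<open>\<delta>\<^sub>n\<close> is exactly the left ideal \<open>(T\<^sub>w - q)\<close>, and the
  isomorphism is that of a cyclic module with the quotient by the annihilator of its generator
  (\<open>cyclic_left_module_iso\<close>).
\<close>

section \<open>Twisted polynomials over a ring with a derivation\<close>

locale derivation =
  fixes d :: "'a::comm_ring_1 \<Rightarrow> 'a"
  assumes d_add: "d (f + g) = d f + d g"
    and d_mult: "d (f * g) = d f * g + f * d g"
begin

sublocale additive d
  by standard (rule d_add)

lemma d_zero [simp]: "d 0 = 0"
  by (rule zero)

lemma d_one [simp]: "d 1 = 0"
  using d_mult[of 1 1] by simp

definition const_coeffs :: "'a poly \<Rightarrow> bool" where
  "const_coeffs p \<longleftrightarrow> (\<forall>i. d (coeff p i) = 0)"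

lemma const_coeffs_pCons [simp]:
  "const_coeffs (pCons a p) \<longleftrightarrow> d a = 0 \<and> const_coeffs p"
  by (auto simp: const_coeffs_def coeff_pCons split: nat.splits)

lemma const_coeffs_0 [simp]: "const_coeffs 0"
  by (simp add: const_coeffs_def)

lemma const_coeffs_1 [simp]: "const_coeffs 1"
  by (simp add: one_pCons)

lemma const_coeffs_mult: "const_coeffs p \<Longrightarrow> const_coeffs r \<Longrightarrow> const_coeffs (p * r)"
  by (simp add: const_coeffs_def coeff_mult d_mult sum)

text \<open>
  A polynomial \<open>\<Sum> f\<^sub>i X\<^sup>i\<close> stands for an operator with coefficients on the left, and \<open>X\<close> obeys
  \<open>X f = f X + d f\<close>; \<open>shift\<close> is left multiplication by \<open>X\<close>.
\<close>

definition shift :: "'a poly \<Rightarrow> 'a poly" where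
  "shift p = pCons 0 p + map_poly d p"

lemma coeff_shift_0 [simp]: "coeff (shift p) 0 = d (coeff p 0)"
  by (simp add: shift_def coeff_map_poly)

lemma coeff_shift_Suc [simp]: "coeff (shift p) (Suc i) = coeff p i + d (coeff p (Suc i))"
  by (simp add: shift_def coeff_map_poly)

lemma shift_add: "shift (p + r) = shift p + shift r"
  by (rule poly_eqI) (case_tac n; simp add: d_add)

lemma shift_smult: "shift (smult f p) = smult f (shift p) + smult (d f) p"
  by (rule poly_eqI) (case_tac n; simp add: d_mult algebra_simps)

lemma shift_const: "const_coeffs p \<Longrightarrow> shift p = pCons 0 p"
  by (rule poly_eqI) (case_tac n; simp add: const_coeffs_def)

lemma degree_map_poly_d_le: "degree (map_poly d p) \<le> degree p"
  by (rule degree_le) (simp add: coeff_map_poly coeff_eq_0)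

end

text \<open>
  A module over the ring of twisted polynomials, given by its scalar multiplication and the
  action \<open>Y\<close> of \<open>X\<close>.
\<close>

locale ore_module = derivation d + Modules.module sc
  for d :: "'a::comm_ring_1 \<Rightarrow> 'a" and sc :: "'a \<Rightarrow> 'm::ab_group_add \<Rightarrow> 'm" +
  fixes Y :: "'m \<Rightarrow> 'm"
  assumes Y_add: "Y (x + y) = Y x + Y y"
    and Y_scale: "Y (sc f x) = sc f (Y x) + sc (d f) x"
begin

sublocale Y: additive Y
  by standard (rule Y_add)

lemma Y_pow_add: "(Y ^^ i) (x + y) = (Y ^^ i) x + (Y ^^ i) y"
  by (induction i) (simp_all add: Y_add)

lemma Y_pow_scale_const: "d f = 0 \<Longrightarrow> (Y ^^ i) (sc f x) = sc f ((Y ^^ i) x)"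
  by (induction i) (simp_all add: Y_scale)

definition ev :: "'a poly \<Rightarrow> 'm \<Rightarrow> 'm" where
  "ev p x = (\<Sum>i\<le>degree p. sc (coeff p i) ((Y ^^ i) x))"

lemma ev_atMost: "degree p \<le> N \<Longrightarrow> ev p x = (\<Sum>i\<le>N. sc (coeff p i) ((Y ^^ i) x))"
  unfolding ev_def by (rule sum.mono_neutral_left) (auto simp: coeff_eq_0)

lemma ev_0 [simp]: "ev 0 x = 0"
  by (simp add: ev_def)

lemma ev_add: "ev (p + r) x = ev p x + ev r x"
proof -
  define N where "N = max (degree p) (degree r)"
  have N: "degree p \<le> N" "degree r \<le> N" "degree (p + r) \<le> N"
    by (auto simp: N_def degree_add_le_max)
  show ?thesis
    unfolding N[THEN ev_atMost] by (simp add: scale_left_distrib sum.distrib)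
qed

sublocale ev: additive "\<lambda>p. ev p x" for x
  by standard (rule ev_add)

lemma ev_smult: "ev (smult f p) x = sc f (ev p x)"
  unfolding ev_atMost[OF degree_smult_le] by (simp add: ev_def scale_sum_right)

lemma ev_pCons: "ev (pCons a p) x = sc a x + ev p (Y x)"
proof -
  have "ev (pCons a p) x =
      sc a x + (\<Sum>i\<le>degree p. sc (coeff p i) ((Y ^^ Suc i) x))"
    unfolding ev_atMost[OF degree_pCons_le] by (subst sum.atMost_Suc_shift) simp
  then show ?thesis
    by (simp only: ev_def funpow_Suc_right o_apply)
qed

lemma ev_const [simp]: "ev [:a:] x = sc a x"
  by (simp add: ev_pCons)

lemma ev_1 [simp]: "ev 1 x = x"
  by (simp add: one_pCons)

lemma ev_add_right: "ev p (x + y) = ev p x + ev p y"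
  by (simp add: ev_def Y_pow_add scale_right_distrib sum.distrib)

sublocale ev_right: additive "ev p" for p
  by standard (rule ev_add_right)

lemma ev_monom: "ev (monom 1 i) x = (Y ^^ i) x"
  by (induction i arbitrary: x) (simp_all add: monom_0 monom_Suc ev_pCons funpow_swap1)

text \<open>
  This is why \<open>shift\<close> is defined as it is: it turns left multiplication by \<open>X\<close> into \<open>Y\<close>.
\<close>

lemma Y_ev: "Y (ev p x) = ev (shift p) x"
proof -
  have "ev (shift p) x = ev (pCons 0 p) x + ev (map_poly d p) x"
    by (simp add: shift_def ev_add)
  also have "ev (map_poly d p) x = (\<Sum>i\<le>degree p. sc (d (coeff p i)) ((Y ^^ i) x))"
    by (subst ev_atMost[OF degree_map_poly_d_le]) (simp add: coeff_map_poly)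
  also have "ev (pCons 0 p) x = (\<Sum>i\<le>degree p. sc (coeff p i) (Y ((Y ^^ i) x)))"
    unfolding ev_pCons by (simp add: ev_def funpow_swap1)
  finally show ?thesis
    by (simp add: ev_def Y.sum Y_scale sum.distrib)
qed

lemma Y_pow_ev: "(Y ^^ i) (ev p x) = ev ((shift ^^ i) p) x"
  by (induction i) (simp_all add: Y_ev)

end

context derivation
begin

sublocale poly: ore_module d smult shift
  by standard (simp_all add: smult_add_right smult_add_left shift_add shift_smult)

text \<open>
  Twisted polynomials act on themselves by left multiplication, so their product is an instance
  of \<open>ev\<close>; \<open>ev_star\<close> then says that every \<open>ore_module\<close> is a module for this product.
\<close>

abbreviation star :: "'a poly \<Rightarrow> 'a poly \<Rightarrow> 'a poly" (infixl "\<star>" 70) where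
  "p \<star> r \<equiv> poly.ev p r"

lemma star_const: "const_coeffs r \<Longrightarrow> p \<star> r = p * r"
  by (induction p arbitrary: r) (simp_all add: poly.ev_pCons shift_const)

end

context ore_module
begin

lemma ev_star: "ev (p \<star> r) x = ev p (ev r x)"
  by (simp add: poly.ev_def ev.sum ev_smult flip: Y_pow_ev) (simp add: ev_def)

lemma ev_mult_const: "const_coeffs r \<Longrightarrow> ev (p * r) x = ev p (ev r x)"
  by (simp flip: ev_star star_const)

end

context ore_module
begin

lemma ev_pCons_const:
  assumes "const_coeffs p"
  shows "ev (pCons a p) x = sc a x + Y (ev p x)"
proof -
  have "pCons a p = [:a:] + shift p"
    using assms by (simp add: shift_const)
  then show ?thesis
    by (simp only: ev_add ev_const Y_ev)
qed

text \<open>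
  Horner's rule read from the inside out: \<open>u r, \<dots>, u 0\<close> are the successive intermediate values in
  the evaluation of \<open>Q\<close>.
\<close>

lemma ev_horner:
  assumes "const_coeffs Q" "degree Q \<le> r"
    and "\<And>i. i < r \<Longrightarrow> u i = Y (u (Suc i)) + sc (coeff Q i) v"
    and "u r = sc (coeff Q r) v"
  shows "ev Q v = u 0"
  using assms
proof (induction r arbitrary: Q u)
  case 0
  then obtain a where "Q = [:a:]"
    by (metis degree_eq_zeroE le_zero_eq)
  with 0 show ?case by simp
next
  case (Suc r)
  obtain a Q' where Q: "Q = pCons a Q'"
    by (cases Q)
  have deg: "degree Q' \<le> r"
    using Suc.prems(2) by (simp add: Q split: if_splits)
  have "ev Q' v = u (Suc 0)"
    using Suc.prems deg
    by (intro Suc.IH[of Q' "\<lambda>i. u (Suc i)"]) (auto simp: Q)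
  with Suc.prems(1,3) show ?case
    using Suc.prems(3)[of 0] by (simp add: Q ev_pCons_const)
qed

lemma ev_scale_const:
  assumes "d f = 0"
  shows "ev p (sc f x) = sc f (ev p x)"
  using assms by (simp add: ev_def Y_pow_scale_const scale_sum_right mult.commute)

text \<open>
  If \<open>d q = h q\<close> then \<open>X q = q (X + h)\<close>, so moving \<open>q\<close> to the left of \<open>p(X)\<close> produces \<open>p(X + h)\<close>.
\<close>

lemma ev_scale_eigen:
  assumes "d q = h * q" "d h = 0"
  shows "ev p (sc q x) = sc q (ev (p \<circ>\<^sub>p [:h, 1:]) x)"
proof (induction p arbitrary: x)
  case (pCons a p)
  have "Y (sc q x) = sc q (ev [:h, 1:] x)"
    using assms by (simp add: Y_scale ev_pCons scale_right_distrib mult.commute add.commute)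
  moreover have "ev (pCons a p \<circ>\<^sub>p [:h, 1:]) x = sc a x + ev (p \<circ>\<^sub>p [:h, 1:]) (ev [:h, 1:] x)"
    unfolding pcompose_pCons mult.commute[of "[:h, 1:]"]
    using assms(2) by (simp only: ev_add ev_const ev_mult_const const_coeffs_pCons d_one
        const_coeffs_0 simp_thms)
  ultimately show ?case
    by (simp only: ev_pCons[of a p] pCons.IH scale_right_distrib scale_left_commute[of a])
qed simp

end

section \<open>Remainders modulo an operator with unit leading coefficient\<close>

text \<open>
  Remainders are obtained without a division algorithm: \<open>companion\<close> is multiplication by \<open>X\<close>
  followed by elimination of \<open>X\<^sup>s\<close> through \<open>t\<close>.  It is semilinear on all polynomials because only
  the coefficient of \<open>X\<^bsup>s-1\<^esup>\<close> enters the correction, hence it makes the polynomials a second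
  \<open>ore_module\<close>, in which \<open>p\<close> sends \<open>1\<close> to its remainder.
\<close>

locale ore_division = derivation d for d :: "'a::comm_ring_1 \<Rightarrow> 'a" +
  fixes t :: "'a poly" and s :: nat and Ci :: 'a
  assumes degree_t: "degree t \<le> s" and s_pos: "s > 0" and lead_t: "Ci * coeff t s = 1"
begin

definition companion :: "'a poly \<Rightarrow> 'a poly" where
  "companion r = shift r - smult (coeff r (s - 1) * Ci) t"

sublocale companion: ore_module d smult companion
  by standard (simp_all add: companion_def shift_add shift_smult smult_diff_right algebra_simps
      smult_add_left)

definition remainder :: "'a poly \<Rightarrow> 'a poly" where
  "remainder p = companion.ev p 1"

lemma companion_below:
  assumes "\<And>i. i \<ge> s \<Longrightarrow> coeff r i = 0" "i \<ge> s"
  shows "coeff (companion r) i = 0"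
proof -
  obtain j where i: "i = Suc j" and j: "j \<ge> s - 1"
    using s_pos assms(2) by (cases i) auto
  show ?thesis
  proof (cases "j = s - 1")
    case True
    then have "i = s" using i s_pos by simp
    with True show ?thesis
      using coeff_shift_Suc[of r "s - 1"] assms(1)[of s] lead_t s_pos
      by (simp add: companion_def mult.assoc)
  next
    case False
    then have "i > s" using i j s_pos by linarith
    then show ?thesis
      using assms(1)[of i] assms(1)[of j] degree_t i False j
      by (simp add: companion_def coeff_eq_0)
  qed
qed

lemma coeff_remainder: "i \<ge> s \<Longrightarrow> coeff (remainder p) i = 0"
proof -
  have "\<forall>i\<ge>s. coeff (companion.ev p r) i = 0" if "\<forall>i\<ge>s. coeff r i = 0" for r
    using that
  proof (induction p arbitrary: r)
    case (pCons a p)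
    have "\<forall>i\<ge>s. coeff (companion r) i = 0"
      using companion_below pCons.prems by blast
    with pCons show ?case by (simp add: companion.ev_pCons)
  qed simp
  from this[of 1] show "i \<ge> s \<Longrightarrow> coeff (remainder p) i = 0"
    using s_pos by (simp add: remainder_def)
qed

lemma companion_pow_one: "i < s \<Longrightarrow> (companion ^^ i) 1 = monom 1 i"
proof (induction i)
  case (Suc i)
  then have "companion (monom 1 i) = shift (monom 1 i)"
    by (simp add: companion_def)
  also have "const_coeffs (monom 1 i)"
    by (simp add: const_coeffs_def)
  then have "shift (monom 1 i) = monom 1 (Suc i)"
    by (simp add: shift_const monom_Suc)
  finally show ?case using Suc by simp
qed simp

lemma remainder_of_less:
  assumes "degree p < s"
  shows "remainder p = p"
proof -
  have "remainder p = (\<Sum>i\<le>degree p. smult (coeff p i) (monom 1 i))"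
    unfolding remainder_def companion.ev_def
    using assms by (intro sum.cong) (auto simp: companion_pow_one)
  also have "\<dots> = p"
    by (simp add: smult_monom poly_as_sum_of_monoms)
  finally show ?thesis .
qed

text \<open>
  All terms of \<open>t\<close> below the top one are their own remainders, and \<open>X\<^sup>s\<close> reduces to
  \<open>X\<^sup>s - Ci t\<close>, so the sum collapses to \<open>t - t\<close>.
\<close>

lemma remainder_t: "remainder t = 0"
proof -
  have s: "{..s} = insert s {..<s}" "s = Suc (s - 1)"
    using s_pos by auto
  have const: "const_coeffs (monom 1 (s - 1))"
    by (simp add: const_coeffs_def)
  have top_monom: "shift (monom 1 (s - Suc 0)) = monom 1 s"
    using shift_const[OF const] monom_Suc[of "1::'a" "s - 1"] s_pos by simp
  have "(companion ^^ s) 1 = companion (monom 1 (s - 1))"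
    using s_pos by (subst s(2)) (simp add: companion_pow_one del: Suc_pred)
  also have "\<dots> = monom 1 s - smult Ci t"
    using s_pos by (simp add: companion_def top_monom)
  finally have top: "(companion ^^ s) 1 = monom 1 s - smult Ci t" .
  have "remainder t = (\<Sum>i\<le>s. smult (coeff t i) ((companion ^^ i) 1))"
    unfolding remainder_def by (rule companion.ev_atMost[OF degree_t])
  also have "\<dots> = smult (coeff t s) (monom 1 s - smult Ci t) +
      (\<Sum>i<s. smult (coeff t i) (monom 1 i))"
    unfolding s(1) by (simp add: top companion_pow_one)
  also have "\<dots> = (\<Sum>i\<le>s. smult (coeff t i) (monom 1 i)) - t"
    unfolding s(1) using lead_t by (simp add: smult_diff_right mult.commute)
  also have "(\<Sum>i\<le>s. smult (coeff t i) (monom 1 i)) = t"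
    using degree_t by (simp add: smult_monom poly_as_sum_of_monoms')
  finally show ?thesis by simp
qed

text \<open>
  The annihilator of an element is a left ideal, so \<open>remainder_t\<close> propagates to all left multiples.
\<close>

lemma remainder_star: "remainder (a \<star> t) = 0"
proof -
  have "remainder (a \<star> t) = companion.ev a (remainder t)"
    by (simp add: remainder_def companion.ev_star)
  then show ?thesis
    by (simp add: remainder_t companion.ev_right.zero)
qed

lemma remainder_congruent: "\<exists>a. p = remainder p + a \<star> t"
proof -
  have "\<exists>a. p \<star> r = companion.ev p r + a \<star> t" for r
  proof (induction p arbitrary: r)
    case 0
    show ?case by (rule exI[of _ 0]) simp
  next
    case (pCons c p)
    define e where "e = coeff r (s - 1) * Ci"
    have "shift r = companion r + smult e t"
      by (simp add: companion_def e_def)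
    moreover obtain a where "p \<star> companion r = companion.ev p (companion r) + a \<star> t"
      using pCons.IH by blast
    moreover have "p \<star> smult e t = (p \<star> [:e:]) \<star> t"
      by (simp add: poly.ev_star)
    ultimately have "pCons c p \<star> r = companion.ev (pCons c p) r + (a + p \<star> [:e:]) \<star> t"
      by (simp add: poly.ev_pCons companion.ev_pCons poly.ev_add_right poly.ev_add)
    then show ?case by blast
  qed
  from this[of 1] show ?thesis
    by (simp add: remainder_def star_const)
qed

end

section \<open>Functionals as sequences\<close>

text \<open>
  \<open>\<sigma>\<close> stands for \<open>f(q, \<hbar>) \<mapsto> f(q, -\<hbar>)\<close>, and \<open>d\<close> for \<open>\<hbar>\<partial>\<close>, which changes sign under it.
\<close>

locale derivation_involution = derivation d for d :: "'a::comm_ring_1 \<Rightarrow> 'a" +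
  fixes \<sigma> :: "'a \<Rightarrow> 'a"
  assumes sigma_add: "\<sigma> (f + g) = \<sigma> f + \<sigma> g"
    and sigma_mult: "\<sigma> (f * g) = \<sigma> f * \<sigma> g"
    and sigma_sigma [simp]: "\<sigma> (\<sigma> f) = f"
    and sigma_one [simp]: "\<sigma> 1 = 1"
    and sigma_d: "\<sigma> (d f) = - d (\<sigma> f)"
begin

sublocale sigma: additive \<sigma>
  by standard (rule sigma_add)

lemma sigma_eq_0_iff [simp]: "\<sigma> f = 0 \<longleftrightarrow> f = 0"
  by (metis sigma.zero sigma_sigma)

text \<open>
  The sequence of values of a functional \<open>\<pi>\<close> at the powers of \<open>X\<close> transforms in this way under the
  sign-reversed dual action of a scalar and of \<open>X\<close>, respectively.
\<close>

definition seq_scale :: "'a \<Rightarrow> (nat \<Rightarrow> 'a) \<Rightarrow> (nat \<Rightarrow> 'a)" where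
  "seq_scale f \<psi> = (\<lambda>k. \<sigma> f * \<psi> k)"

definition seq_shift :: "(nat \<Rightarrow> 'a) \<Rightarrow> (nat \<Rightarrow> 'a)" where
  "seq_shift \<psi> = (\<lambda>k. \<psi> (Suc k) - d (\<psi> k))"

sublocale seq: ore_module d seq_scale seq_shift
  by standard
    (simp_all add: fun_eq_iff seq_scale_def seq_shift_def sigma_add sigma_mult sigma_d d_add
      d_mult algebra_simps)

text \<open>
  The value at \<open>p\<close> of the linear functional with \<open>X\<^sup>k \<mapsto> \<psi> k\<close>.
\<close>

definition pairing :: "(nat \<Rightarrow> 'a) \<Rightarrow> 'a poly \<Rightarrow> 'a" where
  "pairing \<psi> p = (\<Sum>i\<le>degree p. coeff p i * \<psi> i)"

lemma pairing_atMost: "degree p \<le> N \<Longrightarrow> pairing \<psi> p = (\<Sum>i\<le>N. coeff p i * \<psi> i)"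
  unfolding pairing_def by (rule sum.mono_neutral_left) (auto simp: coeff_eq_0)

lemma pairing_add: "pairing \<psi> (p + r) = pairing \<psi> p + pairing \<psi> r"
proof -
  define N where "N = max (degree p) (degree r)"
  have N: "degree p \<le> N" "degree r \<le> N" "degree (p + r) \<le> N"
    by (auto simp: N_def degree_add_le_max)
  show ?thesis
    unfolding N[THEN pairing_atMost] by (simp add: distrib_right sum.distrib)
qed

sublocale pairing: additive "pairing \<psi>" for \<psi>
  by standard (rule pairing_add)

lemma pairing_smult: "pairing \<psi> (smult f p) = f * pairing \<psi> p"
  unfolding pairing_atMost[OF degree_smult_le] by (simp add: pairing_def sum_distrib_left mult.assoc)

lemma pairing_monom [simp]: "pairing \<psi> (monom 1 k) = \<psi> k"
proof -
  have "pairing \<psi> (monom 1 k) = (\<Sum>i\<le>k. if i = k then \<psi> i else 0)"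
    unfolding pairing_atMost[OF degree_monom_le] by (intro sum.cong) auto
  then show ?thesis by simp
qed

lemma pairing_seq_add: "pairing (\<psi> + \<phi>) p = pairing \<psi> p + pairing \<phi> p"
  by (simp add: pairing_def distrib_left sum.distrib)

lemma pairing_seq_scale: "pairing (seq_scale f \<psi>) p = \<sigma> f * pairing \<psi> p"
  by (simp add: pairing_def seq_scale_def sum_distrib_left mult.left_commute)

lemma pairing_seq_shift: "pairing (seq_shift \<psi>) p = pairing \<psi> (shift p) - d (pairing \<psi> p)"
proof -
  have "pairing \<psi> (shift p) = pairing \<psi> (pCons 0 p) + pairing \<psi> (map_poly d p)"
    by (simp add: shift_def pairing_add)
  also have "pairing \<psi> (map_poly d p) = (\<Sum>i\<le>degree p. d (coeff p i) * \<psi> i)"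
    by (simp add: pairing_atMost[OF degree_map_poly_d_le] coeff_map_poly)
  also have "pairing \<psi> (pCons 0 p) = (\<Sum>i\<le>degree p. coeff p i * \<psi> (Suc i))"
    unfolding pairing_atMost[OF degree_pCons_le] by (subst sum.atMost_Suc_shift) simp
  finally show ?thesis
    by (simp add: pairing_def seq_shift_def sum d_mult algebra_simps sum.distrib sum_subtractf)
qed

end

text \<open>
  The functionals on twisted polynomials that vanish on the left ideal generated by \<open>t\<close>, that is,
  the dual of the quotient, form a submodule of the sequences in which an element is determined by
  its first \<open>s\<close> entries.
\<close>

locale dual_sequences = ore_division d t s Ci + derivation_involution d \<sigma>
  for d :: "'a::comm_ring_1 \<Rightarrow> 'a" and t s Ci \<sigma>
begin

definition functionals :: "(nat \<Rightarrow> 'a) set" where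
  "functionals = {\<psi>. \<forall>a. pairing \<psi> (a \<star> t) = 0}"

lemma functionals_0: "0 \<in> functionals"
    and functionals_add: "\<psi> \<in> functionals \<Longrightarrow> \<phi> \<in> functionals \<Longrightarrow> \<psi> + \<phi> \<in> functionals"
    and functionals_scale: "\<psi> \<in> functionals \<Longrightarrow> seq_scale f \<psi> \<in> functionals"
    and functionals_shift: "\<psi> \<in> functionals \<Longrightarrow> seq_shift \<psi> \<in> functionals"
  by (simp_all add: functionals_def pairing_seq_add pairing_seq_scale pairing_seq_shift
      poly.Y_ev) (simp add: pairing_def)

lemma sum_fun_apply: "(\<Sum>i\<in>A. f i) k = (\<Sum>i\<in>A. f i k)"
  by (induction A rule: infinite_finite_induct) simp_all

lemma functionals_sum:
  "(\<And>i. i \<in> A \<Longrightarrow> \<psi> i \<in> functionals) \<Longrightarrow> (\<Sum>i\<in>A. \<psi> i) \<in> functionals"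
  by (induction A rule: infinite_finite_induct) (simp_all add: functionals_0 functionals_add)

lemma pairing_remainder:
  assumes "\<psi> \<in> functionals"
  shows "pairing \<psi> p = (\<Sum>i<s. coeff (remainder p) i * \<psi> i)"
proof -
  obtain a where "p = remainder p + a \<star> t"
    using remainder_congruent by blast
  then have "pairing \<psi> p = pairing \<psi> (remainder p)"
    using assms pairing_add[of \<psi> "remainder p" "a \<star> t"] by (simp add: functionals_def)
  also have "degree (remainder p) \<le> s - 1"
    by (rule degree_le) (use coeff_remainder s_pos in auto)
  then have "pairing \<psi> (remainder p) = (\<Sum>i\<le>s - 1. coeff (remainder p) i * \<psi> i)"
    by (rule pairing_atMost)
  also have "{..s - 1} = {..<s}"
    using s_pos by auto
  finally show ?thesis .
qed

lemma functionals_eqI: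
  assumes "\<psi> \<in> functionals" "\<phi> \<in> functionals" "\<And>i. i < s \<Longrightarrow> \<psi> i = \<phi> i"
  shows "\<psi> = \<phi>"
proof
  fix k
  show "\<psi> k = \<phi> k"
    using pairing_remainder[OF assms(1), of "monom 1 k"]
      pairing_remainder[OF assms(2), of "monom 1 k"] assms(3) by simp
qed

text \<open>
  The sequence of the dual basis element \<open>\<delta>\<^sub>i\<close>.
\<close>

definition dual_seq :: "nat \<Rightarrow> nat \<Rightarrow> 'a" where
  "dual_seq i = (\<lambda>k. coeff (remainder (monom 1 k)) i)"

lemma pairing_dual_seq: "pairing (dual_seq i) p = coeff (remainder p) i"
proof -
  have "remainder p = remainder (\<Sum>k\<le>degree p. smult (coeff p k) (monom 1 k))"
    by (simp add: smult_monom poly_as_sum_of_monoms)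
  also have "\<dots> = (\<Sum>k\<le>degree p. smult (coeff p k) (remainder (monom 1 k)))"
    by (simp add: remainder_def companion.ev.sum companion.ev_smult)
  finally show ?thesis
    by (simp add: coeff_sum pairing_def dual_seq_def)
qed

lemma dual_seq_functional: "dual_seq i \<in> functionals"
  by (simp add: functionals_def pairing_dual_seq remainder_star)

lemma dual_seq_less: "k < s \<Longrightarrow> dual_seq i k = (if k = i then 1 else 0)"
  by (simp add: dual_seq_def remainder_of_less degree_monom_eq)

text \<open>
  The one further entry that is needed comes from the vanishing of the functional at \<open>t\<close>, which
  expresses \<open>X\<^sup>s\<close> through lower powers.
\<close>

lemma dual_seq_s:
  assumes "i < s"
  shows "dual_seq i s = - (Ci * coeff t i)"
proof -
  have "{..s} = insert s {..<s}"
    by auto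
  then have "pairing (dual_seq i) t =
      coeff t s * dual_seq i s + (\<Sum>k<s. coeff t k * dual_seq i k)"
    by (simp add: pairing_atMost[OF degree_t])
  also have "(\<Sum>k<s. coeff t k * dual_seq i k) = (\<Sum>k<s. if k = i then coeff t k else 0)"
    by (intro sum.cong) (auto simp: dual_seq_less)
  also have "\<dots> = coeff t i"
    using assms by simp
  finally have "coeff t s * dual_seq i s + coeff t i = 0"
    by (simp add: pairing_dual_seq remainder_t)
  then have "coeff t s * dual_seq i s = - coeff t i"
    by (rule add_eq_0_iff2[THEN iffD1])
  then have "Ci * (coeff t s * dual_seq i s) = - (Ci * coeff t i)"
    by simp
  then show ?thesis
    using lead_t by (simp flip: mult.assoc)
qed

lemma functional_expansion:
  assumes "\<psi> \<in> functionals"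
  shows "\<psi> = (\<Sum>i<s. seq_scale (\<sigma> (\<psi> i)) (dual_seq i))"
proof (rule functionals_eqI[OF assms])
  show "(\<Sum>i<s. seq_scale (\<sigma> (\<psi> i)) (dual_seq i)) \<in> functionals"
    by (intro functionals_sum functionals_scale dual_seq_functional)
  fix k assume "k < s"
  have "(\<Sum>i<s. seq_scale (\<sigma> (\<psi> i)) (dual_seq i)) k = (\<Sum>i<s. seq_scale (\<sigma> (\<psi> i)) (dual_seq i) k)"
    by (rule sum_fun_apply)
  also have "\<dots> = (\<Sum>i<s. if i = k then \<psi> i else 0)"
    using \<open>k < s\<close> by (intro sum.cong) (auto simp: seq_scale_def dual_seq_less)
  finally show "\<psi> k = (\<Sum>i<s. seq_scale (\<sigma> (\<psi> i)) (dual_seq i)) k"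
    using \<open>k < s\<close> by simp
qed

end

section \<open>Annihilator and cyclicity of the dual basis element\<close>

text \<open>
  What is used of \<open>T\<^sub>w - q\<close>: it has the form \<open>P X\<^bsup>n+1\<^esup> - q\<close> where \<open>P\<close> has \<open>d\<close>-constant coefficients and
  a unit as leading coefficient, \<open>q\<close> is a unit with \<open>d q = h q\<close>, and \<open>P(X + h)\<close> equals \<open>P\<close> with its
  coefficients reflected.
\<close>

locale reflection_symmetric_operator = derivation_involution d \<sigma>
  for d :: "'a::comm_ring_1 \<Rightarrow> 'a" and \<sigma> +
  fixes h q qi C Ci :: 'a and P :: "'a poly" and n r :: nat
  assumes d_h: "d h = 0" and d_q: "d q = h * q" and q_unit: "qi * q = 1" and sigma_q: "\<sigma> q = q"
    and C_unit: "Ci * C = 1" and sigma_C: "\<sigma> C = C"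
    and const_P: "const_coeffs P" and degree_P: "degree P \<le> r" and lead_P: "coeff P r = C"
    and P_reflect: "P \<circ>\<^sub>p [:h, 1:] = map_poly \<sigma> P"
begin

definition s :: nat where "s = Suc (n + r)"

definition t :: "'a poly" where "t = P * monom 1 (Suc n) - [:q:]"

lemma coeff_t: "coeff t i = (if i = 0 then - q else if i \<le> n then 0 else coeff P (i - Suc n))"
  by (auto simp: t_def mult.commute[of P] coeff_monom_mult coeff_pCons split: nat.splits)

lemma sigma_Ci: "\<sigma> Ci = Ci"
proof -
  have "\<sigma> Ci * C = 1"
    using arg_cong[OF C_unit, of \<sigma>] by (simp add: sigma_mult sigma_C)
  then have "\<sigma> Ci * (Ci * C) = Ci"
    by (metis mult.left_commute mult.right_neutral)
  then show ?thesis by (simp add: C_unit)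
qed

lemma d_C: "d C = 0"
  using const_P by (simp add: const_coeffs_def flip: lead_P)

lemma d_Ci: "d Ci = 0"
proof -
  have "d Ci * C = 0"
    using arg_cong[OF C_unit, of d] by (simp add: d_mult d_C)
  then have "d Ci * (Ci * C) = 0"
    by (metis mult.left_commute mult_zero_right)
  then show ?thesis by (simp add: C_unit)
qed

sublocale dual_sequences d t s Ci \<sigma>
proof
  show "degree t \<le> s"
    using degree_P by (intro degree_le) (auto simp: coeff_t s_def coeff_eq_0)
qed (simp_all add: s_def coeff_t lead_P C_unit)

definition Q :: "'a poly" where "Q = map_poly \<sigma> P"

lemma coeff_Q: "coeff Q i = \<sigma> (coeff P i)"
  by (simp add: Q_def coeff_map_poly sigma.zero)

lemma const_Q: "const_coeffs Q"
  using const_P sigma_d by (simp add: const_coeffs_def coeff_Q) (metis neg_equal_0_iff_equal sigma.zero)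

text \<open>
  Only entry \<open>s - 1\<close> of the shifted sequence sees beyond the first \<open>s\<close> entries, hence the single
  correction term.
\<close>

lemma seq_shift_dual_seq:
  assumes "Suc i < s"
  shows "seq_shift (dual_seq (Suc i)) =
    dual_seq i - seq_scale (\<sigma> (Ci * coeff t (Suc i))) (dual_seq (s - 1))"
proof -
  have "seq_shift (dual_seq (Suc i)) + seq_scale (\<sigma> (Ci * coeff t (Suc i))) (dual_seq (s - 1)) = dual_seq i"
  proof (rule functionals_eqI)
    fix k assume "k < s"
    then consider "Suc k < s" | "Suc k = s" by linarith
    then show "(seq_shift (dual_seq (Suc i)) +
        seq_scale (\<sigma> (Ci * coeff t (Suc i))) (dual_seq (s - 1))) k = dual_seq i k"
    proof cases
      case 1
      then show ?thesis
        by (auto simp: seq_shift_def seq_scale_def dual_seq_less)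
    next
      case 2
      then have "dual_seq (Suc i) (Suc k) = - (Ci * coeff t (Suc i))"
        using assms by (simp add: dual_seq_s)
      with 2 assms show ?thesis
        by (auto simp: seq_shift_def seq_scale_def dual_seq_less)
    qed
  qed (intro functionals_add functionals_scale functionals_shift dual_seq_functional)+
  then show ?thesis by (simp add: eq_diff_eq)
qed

lemma seq_shift_dual_seq_0: "seq_shift (dual_seq 0) = seq_scale (Ci * q) (dual_seq (s - 1))"
proof (rule functionals_eqI)
  fix k assume "k < s"
  then consider "Suc k < s" | "Suc k = s" by linarith
  then show "seq_shift (dual_seq 0) k = seq_scale (Ci * q) (dual_seq (s - 1)) k"
  proof cases
    case 1
    then show ?thesis
      by (auto simp: seq_shift_def seq_scale_def dual_seq_less)
  next
    case 2
    have "dual_seq 0 s = Ci * q"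
      using dual_seq_s[of 0] s_pos by (simp add: coeff_t)
    with 2 s_pos show ?thesis
      by (auto simp: seq_shift_def seq_scale_def dual_seq_less sigma_mult sigma_Ci sigma_q)
  qed
qed (intro functionals_scale functionals_shift dual_seq_functional)+

lemma seq_shift_dual_seq_low:
  assumes "i < n"
  shows "seq_shift (dual_seq (Suc i)) = dual_seq i"
  using assms seq_shift_dual_seq[of i] by (simp add: s_def coeff_t sigma.zero)

lemma seq_shift_dual_seq_high:
  assumes "i < r"
  shows "seq_shift (dual_seq (Suc (n + i))) =
    dual_seq (n + i) - seq_scale (Ci * coeff Q i) (dual_seq (s - 1))"
  using assms seq_shift_dual_seq[of "n + i"]
  by (simp add: s_def coeff_t sigma_mult sigma_Ci coeff_Q)

lemma seq_shift_pow_dual_seq: "i \<le> n \<Longrightarrow> (seq_shift ^^ i) (dual_seq n) = dual_seq (n - i)"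
proof (induction i)
  case (Suc i)
  then show ?case
    using seq_shift_dual_seq_low[of "n - Suc i"] by (simp add: Suc_diff_Suc)
qed simp

lemma seq_shift_pow_Suc_n:
  "(seq_shift ^^ Suc n) (dual_seq n) = seq_scale (Ci * q) (dual_seq (s - 1))"
  by (simp add: seq_shift_pow_dual_seq seq_shift_dual_seq_0)

text \<open>
  The relations \<open>seq_shift_dual_seq_high\<close> for \<open>n \<le> i < s - 1\<close> are the steps of Horner's rule.  The
  reflected polynomial \<open>Q\<close> appears because \<open>seq_scale\<close> reflects its scalar.
\<close>

lemma ev_Q: "seq.ev Q (dual_seq (s - 1)) = seq_scale C (dual_seq n)"
proof -
  have "seq.ev Q (dual_seq (s - 1)) = seq_scale C (dual_seq (n + 0))"
  proof (rule seq.ev_horner[where r = r and u = "\<lambda>i. seq_scale C (dual_seq (n + i))"])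
    show "degree Q \<le> r"
      using degree_P by (intro degree_le) (simp add: coeff_Q coeff_eq_0 sigma.zero)
    show "seq_scale C (dual_seq (n + r)) = seq_scale (coeff Q r) (dual_seq (s - 1))"
      by (simp add: coeff_Q lead_P sigma_C s_def)
    fix i assume "i < r"
    have "C * (Ci * coeff Q i) = coeff Q i"
      using C_unit by (simp add: mult.commute flip: mult.assoc)
    with \<open>i < r\<close> show "seq_scale C (dual_seq (n + i)) =
        seq_shift (seq_scale C (dual_seq (n + Suc i))) + seq_scale (coeff Q i) (dual_seq (s - 1))"
      by (simp add: seq.Y_scale d_C seq_shift_dual_seq_high seq.scale_right_diff_distrib)
  qed (rule const_Q)
  then show ?thesis by simp
qed

text \<open>
  \<open>X\<^bsup>n+1\<^esup>\<close> takes \<open>\<delta>\<^sub>n\<close> to \<open>Ci q \<delta>\<^bsub>s-1\<^esub>\<close>; moving \<open>q\<close> past \<open>P\<close> turns \<open>P\<close> into \<open>P(X + h) = Q\<close>, which by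
  \<open>ev_Q\<close> leads back to \<open>\<delta>\<^sub>n\<close>, leaving the factor \<open>q\<close>.
\<close>

theorem annihilates_dual_seq: "seq.ev t (dual_seq n) = 0"
proof -
  have const: "const_coeffs (monom 1 (Suc n))"
    by (simp add: const_coeffs_def)
  have "seq.ev (P * monom 1 (Suc n)) (dual_seq n) =
      seq.ev P (seq_scale q (seq_scale Ci (dual_seq (s - 1))))"
    unfolding seq.ev_mult_const[OF const] seq.ev_monom seq_shift_pow_Suc_n
    by (simp add: mult.commute)
  also have "\<dots> = seq_scale q (seq.ev Q (seq_scale Ci (dual_seq (s - 1))))"
    unfolding seq.ev_scale_eigen[OF d_q d_h] P_reflect Q_def ..
  also have "\<dots> = seq_scale q (seq_scale Ci (seq_scale C (dual_seq n)))"
    by (simp only: seq.ev_scale_const[OF d_Ci] ev_Q)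
  also have "\<dots> = seq_scale q (dual_seq n)"
    by (simp add: mult.assoc C_unit)
  finally show ?thesis
    by (simp add: t_def seq.ev.diff)
qed

text \<open>
  The orbit of \<open>\<delta>\<^sub>n\<close> contains \<open>\<delta>\<^sub>n, \<dots>, \<delta>\<^sub>0\<close>, then \<open>\<delta>\<^bsub>s-1\<^esub>\<close>, and with the help of \<open>\<delta>\<^bsub>s-1\<^esub>\<close> one
  descends from there to \<open>\<delta>\<^bsub>n+1\<^esub>\<close>.
\<close>

theorem dual_seq_cyclic:
  assumes "\<psi> \<in> functionals"
  shows "\<exists>p. \<psi> = seq.ev p (dual_seq n)"
proof -
  define U where "U = range (\<lambda>p. seq.ev p (dual_seq n))"
  have add: "x + y \<in> U" if "x \<in> U" "y \<in> U" for x y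
    using that by (auto simp: U_def simp flip: seq.ev_add)
  have scale: "seq_scale f x \<in> U" if "x \<in> U" for f x
    using that by (auto simp: U_def simp flip: seq.ev_smult)
  have shift: "seq_shift x \<in> U" if "x \<in> U" for x
    using that by (auto simp: U_def seq.Y_ev)
  have pow: "(seq_shift ^^ i) (dual_seq n) \<in> U" for i
    unfolding U_def by (metis rangeI seq.ev_monom)
  have low: "dual_seq i \<in> U" if "i \<le> n" for i
    using pow[of "n - i"] that by (simp add: seq_shift_pow_dual_seq)
  have "seq_scale (qi * C) (seq_scale (Ci * q) (dual_seq (s - 1))) \<in> U"
    using scale[OF pow[of "Suc n"]] by (simp only: seq_shift_pow_Suc_n)
  moreover have "qi * C * (Ci * q) = 1"
    by (metis C_unit q_unit mult.commute mult.left_commute mult.right_neutral)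
  ultimately have top: "dual_seq (s - 1) \<in> U"
    by simp
  have high: "dual_seq (n + i) \<in> U" if "i \<le> r" for i
    using that
  proof (induction rule: inc_induct)
    case base
    show ?case using top by (simp add: s_def)
  next
    case (step i)
    have "dual_seq (n + i) =
        seq_shift (dual_seq (n + Suc i)) + seq_scale (Ci * coeff Q i) (dual_seq (s - 1))"
      using step(2) by (simp add: seq_shift_dual_seq_high)
    then show ?case
      using add[OF shift[OF step(3)] scale[OF top]] by metis
  qed
  have "dual_seq i \<in> U" if "i < s" for i
    using that low[of i] high[of "i - n"] by (cases "i \<le> n") (auto simp: s_def)
  moreover have "0 \<in> U"
    by (auto simp: U_def intro!: image_eqI[of _ _ 0])
  ultimately have "(\<Sum>i\<in>A. seq_scale (\<sigma> (\<psi> i)) (dual_seq i)) \<in> U" if "A \<subseteq> {..<s}" for A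
    using that by (induction A rule: infinite_finite_induct) (auto intro: add scale)
  then have "\<psi> \<in> U"
    using functional_expansion[OF assms] by force
  then show ?thesis by (auto simp: U_def)
qed

text \<open>
  Each shift shortens the initial run of zeros by one and keeps the entry that ends it, because
  \<open>d\<close> is applied to a zero there.
\<close>

lemma seq_shift_pow_upper:
  assumes "\<And>k. k < m \<Longrightarrow> \<psi> k = 0" "i \<le> m"
  shows "k + i < m \<Longrightarrow> (seq_shift ^^ i) \<psi> k = 0" and "(seq_shift ^^ i) \<psi> (m - i) = \<psi> m"
proof -
  have "(\<forall>k. k + i < m \<longrightarrow> (seq_shift ^^ i) \<psi> k = 0) \<and> (seq_shift ^^ i) \<psi> (m - i) = \<psi> m"
    using assms(2)
  proof (induction i)
    case (Suc i)
    then show ?case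
      by (auto simp: seq_shift_def Suc_diff_Suc)
  qed (use assms(1) in simp)
  then show "k + i < m \<Longrightarrow> (seq_shift ^^ i) \<psi> k = 0" and "(seq_shift ^^ i) \<psi> (m - i) = \<psi> m"
    by blast+
qed

text \<open>
  The position at which \<open>X\<^sup>j \<odot> \<delta>\<^sub>n\<close> has a unit entry while all \<open>X\<^sup>i \<odot> \<delta>\<^sub>n\<close> with \<open>i < j\<close> vanish.
  It runs through \<open>n, \<dots>, 0\<close> and then \<open>s - 1, \<dots>, n + 1\<close>.
\<close>

definition pivot :: "nat \<Rightarrow> nat" where
  "pivot j = (if j \<le> n then n - j else s + n - j)"

lemma pivot_triangular:
  assumes "J < s"
  shows "j < J \<Longrightarrow> (seq_shift ^^ j) (dual_seq n) (pivot J) = 0"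
    and "(seq_shift ^^ J) (dual_seq n) (pivot J) \<in> {1, Ci * q}"
proof -
  \<comment> \<open>powers up to \<open>n\<close> give dual basis elements, later ones shift a multiple of \<open>\<delta>\<^bsub>s-1\<^esub>\<close>\<close>
  have low: "(seq_shift ^^ j) (dual_seq n) i = (if i = n - j then 1 else 0)" if "j \<le> n" "i < s" for i j
    using that by (simp add: seq_shift_pow_dual_seq dual_seq_less)
  define \<psi> where "\<psi> = seq_scale (Ci * q) (dual_seq (s - 1))"
  have psi: "\<psi> k = 0" if "k < s - 1" for k
    using that by (simp add: \<psi>_def seq_scale_def dual_seq_less)
  have psi_top: "\<psi> (s - 1) = Ci * q"
    using s_pos by (simp add: \<psi>_def seq_scale_def dual_seq_less sigma_mult sigma_Ci sigma_q)
  have high: "(seq_shift ^^ j) (dual_seq n) = (seq_shift ^^ (j - Suc n)) \<psi>" if "j > n" for j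
  proof -
    have "(seq_shift ^^ (j - Suc n + Suc n)) (dual_seq n) = (seq_shift ^^ (j - Suc n)) \<psi>"
      unfolding funpow_add o_apply seq_shift_pow_Suc_n \<psi>_def ..
    with that show ?thesis by simp
  qed
  show "(seq_shift ^^ J) (dual_seq n) (pivot J) \<in> {1, Ci * q}"
  proof (cases "J \<le> n")
    case True
    then have "n - J < s" by (simp add: s_def)
    with True show ?thesis by (simp add: low pivot_def)
  next
    case False
    then have "pivot J = s - 1 - (J - Suc n)"
      using assms by (simp add: pivot_def s_def)
    with False show ?thesis
      using seq_shift_pow_upper(2)[of "s - 1" \<psi> "J - Suc n"] psi psi_top assms
      by (simp add: high)
  qed
  show "(seq_shift ^^ j) (dual_seq n) (pivot J) = 0" if "j < J"
  proof (cases "j \<le> n")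
    case True
    have "pivot J < s" "pivot J \<noteq> n - j"
      using that assms True by (auto simp: pivot_def s_def)
    with True show ?thesis
      by (simp add: low)
  next
    case False
    then have "pivot J + (j - Suc n) < s - 1"
      using that assms by (simp add: pivot_def s_def)
    with False show ?thesis
      using seq_shift_pow_upper(1)[of "s - 1" \<psi> "j - Suc n" "pivot J"] psi
      by (simp add: high)
  qed
qed

text \<open>
  At the pivot of the degree of \<open>p\<close>, only the leading term of \<open>p\<close> contributes.
\<close>

lemma ev_dual_seq_inj:
  assumes "degree p < s" "seq.ev p (dual_seq n) = 0"
  shows "p = 0"
proof -
  define J where "J = degree p"
  let ?v = "\<lambda>j. (seq_shift ^^ j) (dual_seq n) (pivot J)"
  have "0 = (\<Sum>j\<le>J. \<sigma> (coeff p j) * ?v j)"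
    using arg_cong[OF assms(2), of "\<lambda>\<psi>. \<psi> (pivot J)"]
    by (simp add: seq.ev_def sum_fun_apply seq_scale_def J_def)
  also have "\<dots> = (\<Sum>j\<le>J. if j = J then \<sigma> (coeff p J) * ?v J else 0)"
    using assms(1) pivot_triangular(1)[of J] by (intro sum.cong) (auto simp: J_def)
  finally have "\<sigma> (coeff p J) * ?v J = 0"
    by simp
  moreover have "?v J \<in> {1, Ci * q}"
    using assms(1) pivot_triangular(2) by (simp add: J_def)
  moreover have "Ci * q * (qi * C) = 1"
    by (metis C_unit q_unit mult.commute mult.left_commute mult.right_neutral)
  ultimately have "\<sigma> (coeff p J) = 0"
    by (metis insertE mult.assoc mult.right_neutral mult_zero_left singletonD)
  then show ?thesis
    by (simp add: J_def)
qed

theorem dual_seq_annihilator: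
  "seq.ev p (dual_seq n) = 0 \<longleftrightarrow> (\<exists>a. p = a \<star> t)"
proof
  assume ev0: "seq.ev p (dual_seq n) = 0"
  obtain a where a: "p = remainder p + a \<star> t"
    using remainder_congruent by blast
  have "seq.ev (a \<star> t) (dual_seq n) = 0"
    by (simp add: seq.ev_star annihilates_dual_seq seq.ev_right.zero)
  with ev0 a have "seq.ev (remainder p) (dual_seq n) = 0"
    using seq.ev_add[of "remainder p" "a \<star> t" "dual_seq n"] by simp
  moreover have "degree (remainder p) < s"
    using degree_le[of "s - 1" "remainder p"] coeff_remainder s_pos by fastforce
  ultimately have "remainder p = 0"
    using ev_dual_seq_inj by blast
  with a show "\<exists>a. p = a \<star> t" by auto
qed (auto simp: seq.ev_star annihilates_dual_seq seq.ev_right.zero)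

end

section \<open>Quotients by left ideals and cyclic left modules\<close>

locale left_ideal = ring R + additive_subgroup I R for I and R (structure) +
  assumes left_closed: "a \<in> carrier R \<Longrightarrow> x \<in> I \<Longrightarrow> a \<otimes> x \<in> I"
begin

sublocale abelian_subgroup I R
  by (rule abelian_subgroupI3) (fact is_additive_subgroup abelian_group_axioms)+

lemma coset_eq_iff:
  assumes "x \<in> carrier R" "y \<in> carrier R"
  shows "I +> x = I +> y \<longleftrightarrow> x \<ominus> y \<in> I"
  using assms a_rcos_module_minus[OF ring_axioms assms(2,1)]
  by (metis a_repr_independence' a_rcos_self a_repr_independenceD a_rcos_self)

lemma quot_smult:
  assumes "a \<in> carrier R" "x \<in> carrier R"
  shows "a \<odot>\<^bsub>quot_module R I\<^esub> (I +> x) = I +> (a \<otimes> x)"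
proof -
  have "I +> (a \<otimes> y) = I +> (a \<otimes> x)" if y: "y \<in> I +> x" for y
  proof -
    obtain h where h: "h \<in> I" "y = h \<oplus> x"
      using y by (auto simp: a_r_coset_def')
    have "a \<otimes> y \<ominus> a \<otimes> x = a \<otimes> h"
      using assms h by (simp add: r_distr minus_eq a_assoc r_neg)
    then show ?thesis
      using assms h by (subst coset_eq_iff) (auto simp: left_closed)
  qed
  moreover have "x \<in> I +> x"
    using assms by (simp add: a_rcos_self)
  ultimately have "(\<Union>y\<in>I +> x. I +> (a \<otimes> y)) = I +> (a \<otimes> x)"
    by blast
  then show ?thesis
    by (simp add: quot_module_def)
qed

lemma quot_add:
  assumes "x \<in> carrier R" "y \<in> carrier R"
  shows "(I +> x) \<oplus>\<^bsub>quot_module R I\<^esub> (I +> y) = I +> (x \<oplus> y)"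
  using assms by (simp add: quot_module_def a_rcos_sum)

lemma quot_carrier: "carrier (quot_module R I) = (\<lambda>x. I +> x) ` carrier R"
  by (auto simp: quot_module_def A_RCOSETS_def')

lemma quot_zero: "\<zero>\<^bsub>quot_module R I\<^esub> = I +> \<zero>"
  using a_subset by (simp add: quot_module_def)

lemma quot_left_module: "left_module R (quot_module R I)"
proof -
  interpret M: abelian_group "quot_module R I"
  proof (rule abelian_groupI)
    fix X assume "X \<in> carrier (quot_module R I)"
    then obtain x where x: "x \<in> carrier R" "X = I +> x"
      by (auto simp: quot_carrier)
    then show "\<exists>Y\<in>carrier (quot_module R I). Y \<oplus>\<^bsub>quot_module R I\<^esub> X = \<zero>\<^bsub>quot_module R I\<^esub>"
      by (intro bexI[of _ "I +> \<ominus> x"]) (auto simp: quot_carrier quot_add quot_zero l_neg)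
  qed (auto simp: quot_carrier quot_add quot_zero a_ac)
  show ?thesis
    by unfold_locales
      (auto simp: quot_carrier quot_smult quot_add l_distr r_distr m_assoc)
qed

theorem cyclic_left_module_iso:
  assumes "left_module R N" "v \<in> carrier N"
    and "carrier N = {a \<odot>\<^bsub>N\<^esub> v | a. a \<in> carrier R}"
    and ann: "\<And>a. a \<in> carrier R \<Longrightarrow> a \<odot>\<^bsub>N\<^esub> v = \<zero>\<^bsub>N\<^esub> \<longleftrightarrow> a \<in> I"
  shows "\<exists>\<Phi>. (\<forall>a\<in>carrier R. \<Phi> (I +> a) = a \<odot>\<^bsub>N\<^esub> v) \<and> left_module_iso R (quot_module R I) N \<Phi>"
proof -
  interpret N: left_module R N by fact
  note [simp] = N.smult_closed[OF _ assms(2)]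
  have eq_iff: "a \<odot>\<^bsub>N\<^esub> v = b \<odot>\<^bsub>N\<^esub> v \<longleftrightarrow> I +> a = I +> b"
    if ab: "a \<in> carrier R" "b \<in> carrier R" for a b
  proof -
    have "a \<odot>\<^bsub>N\<^esub> v = ((a \<ominus> b) \<oplus> b) \<odot>\<^bsub>N\<^esub> v"
      using ab by (simp add: minus_eq a_assoc l_neg)
    also have "\<dots> = (a \<ominus> b) \<odot>\<^bsub>N\<^esub> v \<oplus>\<^bsub>N\<^esub> b \<odot>\<^bsub>N\<^esub> v"
      using ab assms(2) by (simp add: N.smult_l_distr)
    finally have "a \<odot>\<^bsub>N\<^esub> v = b \<odot>\<^bsub>N\<^esub> v \<longleftrightarrow> (a \<ominus> b) \<odot>\<^bsub>N\<^esub> v = \<zero>\<^bsub>N\<^esub>"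
      using ab by simp
    then show ?thesis
      using ab by (simp add: ann coset_eq_iff)
  qed
  define \<Phi> where "\<Phi> Z = (SOME a. a \<in> carrier R \<and> Z = I +> a) \<odot>\<^bsub>N\<^esub> v" for Z
  have \<Phi>: "\<Phi> (I +> a) = a \<odot>\<^bsub>N\<^esub> v" if "a \<in> carrier R" for a
  proof -
    have "\<exists>b. b \<in> carrier R \<and> I +> a = I +> b" using that by blast
    from someI_ex[OF this] show ?thesis
      unfolding \<Phi>_def using that eq_iff by metis
  qed
  have "bij_betw \<Phi> (carrier (quot_module R I)) (carrier N)"
    unfolding bij_betw_def inj_on_def quot_carrier
    using eq_iff assms(3) by (auto simp: \<Phi> image_iff)
  then have "left_module_iso R (quot_module R I) N \<Phi>"
    unfolding left_module_iso_def
    using assms(1,2) quot_left_module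
    by (auto simp: quot_carrier quot_add quot_smult \<Phi> N.smult_l_distr N.smult_assoc)
  with \<Phi> show ?thesis by blast
qed

end

section \<open>Operators in normal form\<close>

lemma germ_const_add: "germ_const (a + b) = germ_const a + germ_const b"
  by transfer (simp add: germ_rel_def)

lemma germ_const_diff: "germ_const (a - b) = germ_const a - germ_const b"
  by transfer (simp add: germ_rel_def)

lemma germ_const_mult: "germ_const (a * b) = germ_const a * germ_const b"
  by transfer (simp add: germ_rel_def)

lemma germ_const_0 [simp]: "germ_const 0 = 0"
  by transfer (simp add: germ_rel_def)

lemma germ_const_1 [simp]: "germ_const 1 = 1"
  by transfer (simp add: germ_rel_def)

text \<open>
  A germ killed by \<open>\<hbar>\<close> vanishes in a punctured neighbourhood of \<open>0\<close>, hence at \<open>0\<close> by continuity.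
\<close>

lemma germ_hbar_cancel: "a * germ_hbar = 0 \<Longrightarrow> a = 0"
proof transfer
  fix f :: "complex \<Rightarrow> complex"
  assume "germ_rel (\<lambda>h. f h * h) (\<lambda>_. 0)" "germ_rel f f"
  then have f: "f analytic_on {0}" and ev: "\<forall>\<^sub>F h in nhds 0. f h * h = 0"
    by (simp_all add: germ_rel_def)
  from ev have "\<forall>\<^sub>F h in at 0. f h = 0"
    by (auto simp: eventually_at_filter elim: eventually_mono)
  moreover from this have "f 0 = 0"
  proof -
    have "f \<midarrow>0\<rightarrow> f 0"
      using analytic_at_imp_isCont[OF f] by (simp add: isCont_def)
    moreover have "f \<midarrow>0\<rightarrow> 0"
      using \<open>\<forall>\<^sub>F h in at 0. f h = 0\<close> by (rule tendsto_eventually)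
    ultimately show ?thesis by (rule LIM_unique)
  qed
  ultimately have "\<forall>\<^sub>F h in nhds 0. f h = 0"
    by (simp add: eventually_nhds_conv_at)
  with f show "germ_rel f (\<lambda>_. 0)"
    by (simp add: germ_rel_def)
qed

lemma germ_hbar_power_cancel: "a * germ_hbar ^ i = 0 \<Longrightarrow> a = 0"
  by (induction i arbitrary: a) (auto simp: mult.assoc[symmetric] dest: germ_hbar_cancel)

lemma q_ddq_single:
  "q_ddq l (Poly_Mapping.single k a) =
    Poly_Mapping.single k (germ_const (of_int k / of_nat l) * a)"
  by (rule poly_mapping_eqI) (simp add: lookup_q_ddq lookup_single when_def)

lemma q_ddq_add: "q_ddq l (f + g) = q_ddq l f + q_ddq l g"
  by (rule poly_mapping_eqI) (simp add: lookup_q_ddq lookup_add distrib_left)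

lemma q_ddq_mult: "q_ddq l (f * g) = q_ddq l f * g + f * q_ddq l g"
proof (induction f rule: Defs.coeff_induct)
  case (single k a)
  show ?case
  proof (induction g rule: Defs.coeff_induct)
    case (single j b)
    have "germ_const (of_int (k + j) / of_nat l) =
        germ_const (of_int k / of_nat l) + germ_const (of_int j / of_nat l)"
      by (simp add: add_divide_distrib flip: germ_const_add)
    then show ?case
      by (simp add: q_ddq_single mult_single algebra_simps flip: single_add)
  qed (simp add: q_ddq_add algebra_simps)
qed (simp add: q_ddq_add algebra_simps)

lemma hbar_reflect_one: "hbar_reflect 1 = 1"
  by (simp add: hbar_reflect_single flip: single_one)

interpretation D: derivation_involution "hbar_d l" hbar_reflect for l
proof
  show "hbar_d l (f + g) = hbar_d l f + hbar_d l g"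
    and "hbar_d l (f * g) = hbar_d l f * g + f * hbar_d l g" for f g
    by (simp_all add: hbar_d_def q_ddq_add q_ddq_mult algebra_simps)
  show "hbar_reflect (hbar_d l f) = - hbar_d l (hbar_reflect f)" for f
    using sign_reverse_hbar_d[of l "hbar_reflect f"] by (simp add: sign_reverse_def)
qed (simp_all add: hbar_reflect_add hbar_reflect_mult hbar_reflect_one)

interpretation op: ore_module "hbar_d l" "(*)" "hbar_d l" for l
  by standard (simp_all add: algebra_simps D.d_add D.d_mult)

(* as a rewrite rule this reassociates products and loops with mult.assoc *)
declare op.scale_scale [simp del]

abbreviation diff_op :: "nat \<Rightarrow> coeff poly \<Rightarrow> coeff \<Rightarrow> coeff" where
  "diff_op \<equiv> op.ev"

lemma lookup_times_single:
  fixes f :: coeff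
  shows "Poly_Mapping.lookup (f * Poly_Mapping.single k a) (m + k) = Poly_Mapping.lookup f m * a"
  by (induction f rule: Defs.coeff_induct)
    (simp_all add: mult_single lookup_single when_def distrib_right lookup_add)

lemma hbar_d_single:
  "hbar_d l (Poly_Mapping.single k a) =
    Poly_Mapping.single k (germ_hbar * germ_const (of_int k / of_nat l) * a)"
  by (simp add: hbar_d_def hbar_def q_ddq_single mult_single mult.assoc)

lemma hbar_d_pow_single:
  "(hbar_d l ^^ i) (Poly_Mapping.single k 1) =
    Poly_Mapping.single k (germ_hbar ^ i * germ_const (of_int k / of_nat l) ^ i)"
  by (induction i) (simp_all add: hbar_d_single mult_ac)

text \<open>
  In the presence of zero divisors, splitting off one linear factor after another still works as
  long as the differences of the zeros can be cancelled.
\<close>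

lemma poly_eq_0_of_infinite_zeros:
  fixes p :: "'a::comm_ring_1 poly"
  assumes "infinite S" "\<And>a. a \<in> S \<Longrightarrow> poly p a = 0"
    and "\<And>a b c. a \<in> S \<Longrightarrow> b \<in> S \<Longrightarrow> a \<noteq> b \<Longrightarrow> (a - b) * c = 0 \<Longrightarrow> c = 0"
  shows "p = 0"
  using assms
proof (induction "degree p" arbitrary: p S rule: less_induct)
  case less
  obtain a where a: "a \<in> S"
    using less.prems(1) by fastforce
  then have "[:- a, 1:] dvd p"
    using less.prems(2) by (simp add: poly_eq_0_iff_dvd)
  then obtain r where r: "p = [:- a, 1:] * r" ..
  have zeros: "poly r b = 0" if "b \<in> S - {a}" for b
    using less.prems(2)[of b] less.prems(3)[of b a "poly r b"] a that by (auto simp: r algebra_simps)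
  show ?case
  proof (rule ccontr)
    assume "p \<noteq> 0"
    then have "r \<noteq> 0" by (auto simp: r)
    moreover have "coeff p (Suc (degree r)) = lead_coeff r"
      by (simp add: r coeff_eq_0)
    ultimately have "degree r < degree p"
      by (metis Suc_le_lessD le_degree leading_coeff_0_iff)
    then have "r = 0"
      using less.hyps[of r "S - {a}"] less.prems zeros by auto
    with \<open>r \<noteq> 0\<close> show False by contradiction
  qed
qed

text \<open>
  Applied to \<open>q\<^bsup>k/l\<^esup>\<close>, the operator \<open>\<Sum> p\<^sub>i (\<hbar>\<partial>)\<^sup>i\<close> multiplies by \<open>\<Sum> p\<^sub>i (\<hbar>k/l)\<^sup>i\<close>.  For each power of
  \<open>q\<close> in the coefficients this is a polynomial in \<open>k/l\<close> over the germs, vanishing for all integers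
  \<open>k\<close>.
\<close>

theorem diff_op_eq_0:
  assumes "l > 0" "diff_op l p = (\<lambda>_. 0)"
  shows "p = 0"
proof (rule poly_eqI, rule poly_mapping_eqI)
  fix i m
  define g where "g = (\<Sum>i\<le>degree p. monom (Poly_Mapping.lookup (coeff p i) m * germ_hbar ^ i) i)"
  define S where "S = range (\<lambda>k::int. germ_const (of_int k / of_nat l))"
  have cancel: "c = 0" if "j \<noteq> k"
    "(germ_const (of_int j / of_nat l) - germ_const (of_int k / of_nat l)) * c = 0" for j k :: int and c
  proof -
    define z :: complex where "z = of_int j / of_nat l - of_int k / of_nat l"
    have "z \<noteq> 0"
      using assms(1) that(1) by (simp add: z_def)
    have "germ_const (1 / z) * (germ_const z * c) = 0"
      using that(2) by (simp add: z_def germ_const_diff)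
    moreover have "germ_const (1 / z) * germ_const z = 1"
      using \<open>z \<noteq> 0\<close> by (simp flip: germ_const_mult)
    ultimately show ?thesis
      by (simp flip: mult.assoc)
  qed
  have "inj (\<lambda>k::int. germ_const (of_int k / of_nat l))"
  proof (rule injI)
    fix j k :: int
    assume "germ_const (of_int j / of_nat l) = germ_const (of_int k / of_nat l)"
    then show "j = k"
      using cancel[of j k 1] by auto
  qed
  then have "infinite S"
    unfolding S_def by (meson finite_imageD infinite_UNIV_int)
  moreover have "poly g a = 0" if a_in: "a \<in> S" for a
  proof -
    obtain k :: int where a: "a = germ_const (of_int k / of_nat l)"
      using a_in by (auto simp: S_def)
    have "0 = Poly_Mapping.lookup (diff_op l p (Poly_Mapping.single k 1)) (m + k)"
      by (simp add: assms(2))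
    also have "\<dots> = (\<Sum>i\<le>degree p. Poly_Mapping.lookup (coeff p i) m * (germ_hbar ^ i * a ^ i))"
      by (simp add: op.ev_def hbar_d_pow_single lookup_sum lookup_times_single a)
    also have "\<dots> = poly g a"
      by (simp add: g_def poly_sum poly_monom mult.assoc)
    finally show ?thesis by simp
  qed
  moreover have "c = 0" if ab: "a \<in> S" "b \<in> S" "a \<noteq> b" "(a - b) * c = 0" for a b c
  proof -
    obtain j k :: int where "a = germ_const (of_int j / of_nat l)" "b = germ_const (of_int k / of_nat l)"
      using ab(1,2) by (auto simp: S_def)
    then show ?thesis
      using ab(3,4) cancel[of j k c] by auto
  qed
  ultimately have "g = 0"
    by (rule poly_eq_0_of_infinite_zeros)
  show "Poly_Mapping.lookup (coeff p i) m = Poly_Mapping.lookup (coeff 0 i) m"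
  proof (cases "i \<le> degree p")
    case True
    then have "coeff g i = Poly_Mapping.lookup (coeff p i) m * germ_hbar ^ i"
      by (simp add: g_def coeff_sum)
    then show ?thesis
      using \<open>g = 0\<close> by (auto dest: germ_hbar_power_cancel)
  qed (simp add: coeff_eq_0)
qed

corollary diff_op_inj: "l > 0 \<Longrightarrow> diff_op l p = diff_op l r \<longleftrightarrow> p = r"
  using diff_op_eq_0[of l "p - r"] by (auto simp: fun_eq_iff op.ev.diff)

lemma additive_End_ring: "ring additive_End"
proof -
  have "abelian_group additive_End"
  proof (rule abelian_groupI)
    fix \<phi> assume "\<phi> \<in> carrier additive_End"
    then have "(\<lambda>f. - \<phi> f) \<in> carrier additive_End"
      by (simp add: additive_End_def additive_def)
    then show "\<exists>\<psi>\<in>carrier additive_End. \<psi> \<oplus>\<^bsub>additive_End\<^esub> \<phi> = \<zero>\<^bsub>additive_End\<^esub>"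
      by (rule bexI[rotated]) (simp add: additive_End_def)
  qed (auto simp: additive_End_def additive_def fun_eq_iff algebra_simps)
  moreover have "Group.monoid additive_End"
    by (rule monoidI) (auto simp: additive_End_def additive_def fun_eq_iff)
  ultimately show ?thesis
    by (rule ringI) (auto simp: additive_End_def additive_def fun_eq_iff)
qed

interpretation End: ring additive_End
  by (rule additive_End_ring)

lemma additive_End_simps [simp]:
  "carrier additive_End = {\<phi>. additive \<phi>}"
  "\<phi> \<otimes>\<^bsub>additive_End\<^esub> \<psi> = \<phi> \<circ> \<psi>" "\<one>\<^bsub>additive_End\<^esub> = id"
  "\<phi> \<oplus>\<^bsub>additive_End\<^esub> \<psi> = (\<lambda>f. \<phi> f + \<psi> f)" "\<zero>\<^bsub>additive_End\<^esub> = (\<lambda>_. 0)"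
  by (simp_all add: additive_End_def)

lemma additive_End_uminus:
  assumes "additive \<phi>"
  shows "\<ominus>\<^bsub>additive_End\<^esub> \<phi> = (\<lambda>f. - \<phi> f)"
  using assms by (intro End.minus_equality) (auto simp: additive_def)

lemma diff_op_ring_simps [simp]:
  "\<phi> \<otimes>\<^bsub>diff_op_ring l\<^esub> \<psi> = \<phi> \<circ> \<psi>" "\<one>\<^bsub>diff_op_ring l\<^esub> = id"
  "\<phi> \<oplus>\<^bsub>diff_op_ring l\<^esub> \<psi> = (\<lambda>f. \<phi> f + \<psi> f)" "\<zero>\<^bsub>diff_op_ring l\<^esub> = (\<lambda>_. 0)"
  by (simp_all add: diff_op_ring_def)

lemma generators_subset: "insert (hbar_d l) (range mult_op) \<subseteq> carrier additive_End"
  by (auto simp: additive_def D.d_add mult_op_def distrib_left)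

lemma diff_op_ring_ring: "ring (diff_op_ring l)"
  unfolding diff_op_ring_def
  by (rule End.generate_ring_is_ring[OF generators_subset])

lemma mult_op_in_carrier [simp]: "mult_op f \<in> carrier (diff_op_ring l)"
  and hbar_d_in_carrier [simp]: "hbar_d l \<in> carrier (diff_op_ring l)"
  by (auto simp: diff_op_ring_def intro: generate_ring.incl)

lemma diff_op_pCons:
  "diff_op l (pCons a p) = mult_op a \<oplus>\<^bsub>diff_op_ring l\<^esub> diff_op l p \<otimes>\<^bsub>diff_op_ring l\<^esub> hbar_d l"
  by (simp add: fun_eq_iff op.ev_pCons mult_op_def)

lemma diff_op_star: "diff_op l (D.poly.ev l p r) = diff_op l p \<circ> diff_op l r"
  by (simp add: fun_eq_iff op.ev_star)

lemma carrier_diff_op_ring: "carrier (diff_op_ring l) = range (diff_op l)"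
proof
  interpret D: ring "diff_op_ring l" by (rule diff_op_ring_ring)
  show "range (diff_op l) \<subseteq> carrier (diff_op_ring l)"
  proof safe
    fix p show "diff_op l p \<in> carrier (diff_op_ring l)"
    proof (induction p)
      case 0
      have "diff_op l 0 = \<zero>\<^bsub>diff_op_ring l\<^esub>"
        by (simp add: fun_eq_iff)
      then show ?case by (simp only: D.zero_closed)
    next
      case (pCons a p)
      then show ?case
        unfolding diff_op_pCons by (intro D.a_closed D.m_closed mult_op_in_carrier hbar_d_in_carrier)
    qed
  qed
  have "P \<in> range (diff_op l)" if "P \<in> generate_ring additive_End (insert (hbar_d l) (range mult_op))" for P
    using that
  proof induction
    case one
    have "id = diff_op l 1" by (simp add: fun_eq_iff)
    then show ?case unfolding additive_End_simps by (rule range_eqI)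
  next
    case (incl P)
    then consider "P = hbar_d l" | f where "P = mult_op f" by blast
    then show ?case
    proof cases
      case 1
      then have "P = diff_op l [:0, 1:]" by (simp add: fun_eq_iff op.ev_pCons)
      then show ?thesis by blast
    next
      case 2
      then have "P = diff_op l [:f:]" by (simp add: fun_eq_iff mult_op_def)
      then show ?thesis by blast
    qed
  next
    case (a_inv P)
    then obtain p where p: "P = diff_op l p" by blast
    have "additive P" by (simp add: p additive_def op.ev_add_right)
    then have "\<ominus>\<^bsub>additive_End\<^esub> P = diff_op l (- p)"
      by (simp add: additive_End_uminus p fun_eq_iff op.ev.minus)
    then show ?case by blast
  next
    case (eng_add P Q)
    then obtain p r where "P = diff_op l p" "Q = diff_op l r" by blast
    then have "P \<oplus>\<^bsub>additive_End\<^esub> Q = diff_op l (p + r)"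
      by (simp add: fun_eq_iff op.ev_add)
    then show ?case by blast
  next
    case (eng_mult P Q)
    then obtain p r where "P = diff_op l p" "Q = diff_op l r" by blast
    then have "P \<otimes>\<^bsub>additive_End\<^esub> Q = diff_op l (D.poly.ev l p r)"
      by (simp add: diff_op_star)
    then show ?case by blast
  qed
  then show "carrier (diff_op_ring l) \<subseteq> range (diff_op l)"
    by (auto simp: diff_op_ring_def)
qed

section \<open>The dual action\<close>

lemma left_module_diff_op_pCons:
  assumes "left_module (diff_op_ring l) K" "x \<in> carrier K"
  shows "diff_op l (pCons a p) \<odot>\<^bsub>K\<^esub> x =
    mult_op a \<odot>\<^bsub>K\<^esub> x \<oplus>\<^bsub>K\<^esub> diff_op l p \<odot>\<^bsub>K\<^esub> (hbar_d l \<odot>\<^bsub>K\<^esub> x)"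
proof -
  interpret K: left_module "diff_op_ring l" K by fact
  have p: "diff_op l p \<in> carrier (diff_op_ring l)"
    by (simp add: carrier_diff_op_ring)
  then show ?thesis
    unfolding diff_op_pCons using assms(2)
    by (subst K.smult_l_distr) (simp_all only: mult_op_in_carrier hbar_d_in_carrier
        K.R.m_closed K.smult_assoc)
qed

locale diff_op_module = left_module "diff_op_ring l" M
  for l :: nat and M :: "'b coeff_module" +
  assumes l_pos: "l > 0"
begin

definition fun_scale :: "coeff \<Rightarrow> ('b \<Rightarrow> coeff) \<Rightarrow> ('b \<Rightarrow> coeff)" where
  "fun_scale f \<pi> = (\<lambda>X. f * \<pi> X)"

text \<open>
  The prescribed dual action of \<open>\<hbar>\<partial>\<close>, on all functions and without the restriction to the carrier,
  so that the total functions form an \<open>ore_module\<close> whatever the values outside the carrier.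
\<close>

definition contragredient :: "('b \<Rightarrow> coeff) \<Rightarrow> ('b \<Rightarrow> coeff)" where
  "contragredient \<pi> = (\<lambda>X. - \<pi> (hbar_d l \<odot>\<^bsub>M\<^esub> X) + hbar_d l (\<pi> X))"

lemma contragredient_ore_module: "ore_module (hbar_d l) fun_scale contragredient"
proof (intro ore_module.intro Modules.module.intro ore_module_axioms.intro)
  show "derivation (hbar_d l)"
    by (rule D.derivation_axioms)
  fix f g :: coeff and \<pi> \<rho> :: "'b \<Rightarrow> coeff"
  show "fun_scale f (\<pi> + \<rho>) = fun_scale f \<pi> + fun_scale f \<rho>"
    and "fun_scale (f + g) \<pi> = fun_scale f \<pi> + fun_scale g \<pi>"
    and "fun_scale 1 \<pi> = \<pi>"
    by (rule ext; simp add: fun_scale_def distrib_left distrib_right)+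
  show "fun_scale f (fun_scale g \<pi>) = fun_scale (f * g) \<pi>"
    unfolding fun_scale_def mult.assoc by (rule refl)
  show "contragredient (\<pi> + \<rho>) = contragredient \<pi> + contragredient \<rho>"
    by (rule ext) (simp add: contragredient_def D.d_add)
  show "contragredient (fun_scale f \<pi>) = fun_scale f (contragredient \<pi>) + fun_scale (hbar_d l f) \<pi>"
    by (rule ext) (simp add: contragredient_def fun_scale_def D.d_mult right_diff_distrib)
qed

sublocale contra: ore_module "hbar_d l" fun_scale contragredient
  by (rule contragredient_ore_module)

lemma contra_ev_pCons_apply:
  "contra.ev (pCons a p) \<pi> X = a * \<pi> X + contra.ev p (contragredient \<pi>) X"
  unfolding contra.ev_pCons by (simp add: fun_scale_def)

definition linear_on_carrier :: "('b \<Rightarrow> coeff) \<Rightarrow> bool" where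
  "linear_on_carrier \<pi> \<longleftrightarrow>
     (\<forall>X\<in>carrier M. \<forall>Y\<in>carrier M. \<pi> (X \<oplus>\<^bsub>M\<^esub> Y) = \<pi> X + \<pi> Y) \<and>
     (\<forall>f. \<forall>X\<in>carrier M. \<pi> (mult_op f \<odot>\<^bsub>M\<^esub> X) = f * \<pi> X)"

lemma dual_set_iff: "\<pi> \<in> dual_set M \<longleftrightarrow> \<pi> \<in> extensional (carrier M) \<and> linear_on_carrier \<pi>"
  by (simp add: dual_set_def linear_on_carrier_def)

lemma dual_set_linear: "\<pi> \<in> dual_set M \<Longrightarrow> linear_on_carrier \<pi>"
  by (simp add: dual_set_iff)

lemma restrict_dual_set: "linear_on_carrier \<pi> \<Longrightarrow> restrict \<pi> (carrier M) \<in> dual_set M"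
  by (simp add: dual_set_def linear_on_carrier_def smult_closed)

lemma linear_add: "linear_on_carrier \<pi> \<Longrightarrow> linear_on_carrier \<rho> \<Longrightarrow> linear_on_carrier (\<pi> + \<rho>)"
  by (simp add: linear_on_carrier_def distrib_left)

lemma linear_scale: "linear_on_carrier \<pi> \<Longrightarrow> linear_on_carrier (fun_scale f \<pi>)"
  by (simp add: linear_on_carrier_def fun_scale_def algebra_simps)

lemma hbar_d_smult_mult_op:
  assumes "X \<in> carrier M"
  shows "hbar_d l \<odot>\<^bsub>M\<^esub> (mult_op f \<odot>\<^bsub>M\<^esub> X) =
    mult_op f \<odot>\<^bsub>M\<^esub> (hbar_d l \<odot>\<^bsub>M\<^esub> X) \<oplus>\<^bsub>M\<^esub> mult_op (hbar_d l f) \<odot>\<^bsub>M\<^esub> X"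
proof -
  let ?D = "diff_op_ring l"
  have "hbar_d l \<otimes>\<^bsub>?D\<^esub> mult_op f = mult_op f \<otimes>\<^bsub>?D\<^esub> hbar_d l \<oplus>\<^bsub>?D\<^esub> mult_op (hbar_d l f)"
    by (simp add: fun_eq_iff mult_op_def D.d_mult)
  then have "(hbar_d l \<otimes>\<^bsub>?D\<^esub> mult_op f) \<odot>\<^bsub>M\<^esub> X =
      (mult_op f \<otimes>\<^bsub>?D\<^esub> hbar_d l \<oplus>\<^bsub>?D\<^esub> mult_op (hbar_d l f)) \<odot>\<^bsub>M\<^esub> X"
    by (rule arg_cong)
  then show ?thesis
    using assms by (simp only: smult_assoc smult_l_distr mult_op_in_carrier hbar_d_in_carrier
        R.m_closed)
qed

lemma linear_contragredient: "linear_on_carrier \<pi> \<Longrightarrow> linear_on_carrier (contragredient \<pi>)"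
  by (simp add: linear_on_carrier_def contragredient_def smult_r_distr smult_closed
      hbar_d_smult_mult_op D.d_add D.d_mult algebra_simps)

lemma linear_ev: "linear_on_carrier \<pi> \<Longrightarrow> linear_on_carrier (contra.ev p \<pi>)"
proof (induction p arbitrary: \<pi>)
  case 0
  show ?case by (simp add: linear_on_carrier_def)
next
  case (pCons a p)
  then show ?case
    unfolding contra.ev_pCons by (intro linear_add linear_scale pCons.IH linear_contragredient)
qed

text \<open>
  The carrier is closed under \<open>\<hbar>\<partial>\<close>, so the values of a function outside it never influence those
  inside, and restriction to the carrier is compatible with the action.
\<close>

lemma ev_local:
  assumes "\<And>X. X \<in> carrier M \<Longrightarrow> \<pi> X = \<rho> X" "X \<in> carrier M"
  shows "contra.ev p \<pi> X = contra.ev p \<rho> X"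
  using assms
proof (induction p arbitrary: \<pi> \<rho>)
  case (pCons a p)
  have "contragredient \<pi> Y = contragredient \<rho> Y" if "Y \<in> carrier M" for Y
    using that pCons.prems(1) by (simp add: contragredient_def smult_closed)
  then have "contra.ev p (contragredient \<pi>) X = contra.ev p (contragredient \<rho>) X"
    using pCons.IH pCons.prems(2) by blast
  then show ?case
    using pCons.prems by (simp only: contra_ev_pCons_apply)
qed simp

definition normal_form :: "(coeff \<Rightarrow> coeff) \<Rightarrow> coeff poly" where
  "normal_form P = (THE p. P = diff_op l p)"

lemma normal_form_diff_op [simp]: "normal_form (diff_op l p) = p"
  by (simp add: normal_form_def diff_op_inj[OF l_pos])

text \<open>
  Well defined because normal forms are unique.
\<close>

definition dual_action :: "(coeff \<Rightarrow> coeff) \<Rightarrow> ('b \<Rightarrow> coeff) \<Rightarrow> ('b \<Rightarrow> coeff)" where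
  "dual_action = (\<lambda>P\<in>carrier (diff_op_ring l). \<lambda>\<pi>\<in>dual_set M.
     restrict (contra.ev (normal_form P) \<pi>) (carrier M))"

lemma dual_action_diff_op:
  "\<pi> \<in> dual_set M \<Longrightarrow> dual_action (diff_op l p) \<pi> = restrict (contra.ev p \<pi>) (carrier M)"
  by (simp add: dual_action_def carrier_diff_op_ring)

lemma dual_action_closed: "\<pi> \<in> dual_set M \<Longrightarrow> dual_action (diff_op l p) \<pi> \<in> dual_set M"
  by (simp add: dual_action_diff_op restrict_dual_set linear_ev dual_set_linear)

lemma dual_set_add:
  "\<pi> \<in> dual_set M \<Longrightarrow> \<rho> \<in> dual_set M \<Longrightarrow> (\<lambda>X\<in>carrier M. \<pi> X + \<rho> X) \<in> dual_set M"
  using restrict_dual_set[OF linear_add, of \<pi> \<rho>] by (simp add: dual_set_linear plus_fun_def)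

lemma restrict_dual_set_id: "\<pi> \<in> dual_set M \<Longrightarrow> restrict \<pi> (carrier M) = \<pi>"
  by (simp add: dual_set_iff extensional_restrict)

lemma dual_abelian_group: "abelian_group (dual_module_with M act)"
proof (rule abelian_groupI)
  fix \<pi> assume "\<pi> \<in> carrier (dual_module_with M act)"
  then have \<pi>: "\<pi> \<in> dual_set M"
    by (simp add: dual_module_with_def)
  then have "restrict (fun_scale (- 1) \<pi>) (carrier M) \<in> dual_set M"
    by (intro restrict_dual_set linear_scale dual_set_linear)
  then show "\<exists>\<rho>\<in>carrier (dual_module_with M act).
      \<rho> \<oplus>\<^bsub>dual_module_with M act\<^esub> \<pi> = \<zero>\<^bsub>dual_module_with M act\<^esub>"
    by (intro bexI[of _ "restrict (fun_scale (- 1) \<pi>) (carrier M)"])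
      (auto simp: dual_module_with_def fun_scale_def)
next
  have "linear_on_carrier (\<lambda>_. 0)"
    by (simp add: linear_on_carrier_def)
  then show "\<zero>\<^bsub>dual_module_with M act\<^esub> \<in> carrier (dual_module_with M act)"
    using restrict_dual_set by (simp add: dual_module_with_def)
next
  fix \<pi> assume "\<pi> \<in> carrier (dual_module_with M act)"
  then have "restrict \<pi> (carrier M) = \<pi>"
    by (simp add: dual_module_with_def restrict_dual_set_id)
  moreover have "\<zero>\<^bsub>dual_module_with M act\<^esub> \<oplus>\<^bsub>dual_module_with M act\<^esub> \<pi> = restrict \<pi> (carrier M)"
    by (auto simp: dual_module_with_def)
  ultimately show "\<zero>\<^bsub>dual_module_with M act\<^esub> \<oplus>\<^bsub>dual_module_with M act\<^esub> \<pi> = \<pi>"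
    by simp
qed (auto simp: dual_module_with_def dual_set_add add_ac intro!: restrict_ext)

lemma is_dual_action_dual_action: "is_dual_action l M dual_action"
  unfolding is_dual_action_def
proof (intro conjI allI ballI)
  let ?D = "diff_op_ring l"
  show "dual_action \<in> carrier ?D \<rightarrow>\<^sub>E (dual_set M \<rightarrow>\<^sub>E dual_set M)"
  proof
    show "dual_action P \<in> dual_set M \<rightarrow>\<^sub>E dual_set M" if "P \<in> carrier ?D" for P
    proof
      show "dual_action P \<pi> \<in> dual_set M" if "\<pi> \<in> dual_set M" for \<pi>
        using that \<open>P \<in> carrier ?D\<close> by (auto simp: carrier_diff_op_ring dual_action_closed)
      show "dual_action P \<pi> = undefined" if "\<pi> \<notin> dual_set M" for \<pi>
        using that \<open>P \<in> carrier ?D\<close> by (simp add: dual_action_def)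
    qed
    show "dual_action P = undefined" if "P \<notin> carrier ?D" for P
      using that by (simp add: dual_action_def)
  qed
  interpret N: abelian_group "dual_module_with M dual_action"
    by (rule dual_abelian_group)
  show "left_module ?D (dual_module_with M dual_action)"
  proof unfold_locales
    fix P Q \<pi> \<rho>
    assume P: "P \<in> carrier ?D" and \<pi>: "\<pi> \<in> carrier (dual_module_with M dual_action)"
    then obtain p where p: "P = diff_op l p" by (auto simp: carrier_diff_op_ring)
    have \<pi>': "\<pi> \<in> dual_set M" using \<pi> by (simp add: dual_module_with_def)
    show "P \<odot>\<^bsub>dual_module_with M dual_action\<^esub> \<pi> \<in> carrier (dual_module_with M dual_action)"
      using \<pi>' by (simp add: dual_module_with_def p dual_action_closed)
    {
      assume "\<rho> \<in> carrier (dual_module_with M dual_action)"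
      then have "\<rho> \<in> dual_set M" by (simp add: dual_module_with_def)
      moreover have "contra.ev p (\<lambda>X\<in>carrier M. \<pi> X + \<rho> X) X = contra.ev p (\<pi> + \<rho>) X"
        if "X \<in> carrier M" for X
        using that by (intro ev_local) auto
      ultimately show "P \<odot>\<^bsub>dual_module_with M dual_action\<^esub> (\<pi> \<oplus>\<^bsub>dual_module_with M dual_action\<^esub> \<rho>) =
          P \<odot>\<^bsub>dual_module_with M dual_action\<^esub> \<pi> \<oplus>\<^bsub>dual_module_with M dual_action\<^esub>
          P \<odot>\<^bsub>dual_module_with M dual_action\<^esub> \<rho>"
        using \<pi>' by (auto simp: dual_module_with_def p dual_action_diff_op dual_set_add
            contra.ev_add_right intro!: restrict_ext)
    }
    assume "Q \<in> carrier ?D"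
    then obtain r where r: "Q = diff_op l r" by (auto simp: carrier_diff_op_ring)
    have "P \<oplus>\<^bsub>?D\<^esub> Q = diff_op l (p + r)"
      by (simp add: p r fun_eq_iff op.ev_add)
    then show "(P \<oplus>\<^bsub>?D\<^esub> Q) \<odot>\<^bsub>dual_module_with M dual_action\<^esub> \<pi> =
        P \<odot>\<^bsub>dual_module_with M dual_action\<^esub> \<pi> \<oplus>\<^bsub>dual_module_with M dual_action\<^esub>
        Q \<odot>\<^bsub>dual_module_with M dual_action\<^esub> \<pi>"
      using \<pi>' by (auto simp: dual_module_with_def p r dual_action_diff_op contra.ev_add
          simp del: diff_op_ring_simps intro!: restrict_ext)
    have "P \<otimes>\<^bsub>?D\<^esub> Q = diff_op l (D.poly.ev l p r)"
      by (simp add: p r diff_op_star)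
    moreover have "contra.ev p (restrict (contra.ev r \<pi>) (carrier M)) X = contra.ev p (contra.ev r \<pi>) X"
      if "X \<in> carrier M" for X
      using that by (intro ev_local) auto
    ultimately show "(P \<otimes>\<^bsub>?D\<^esub> Q) \<odot>\<^bsub>dual_module_with M dual_action\<^esub> \<pi> =
        P \<odot>\<^bsub>dual_module_with M dual_action\<^esub> (Q \<odot>\<^bsub>dual_module_with M dual_action\<^esub> \<pi>)"
      using \<pi>' dual_action_closed[OF \<pi>', of r]
      by (auto simp: dual_module_with_def p r dual_action_diff_op contra.ev_star
          simp del: diff_op_ring_simps intro!: restrict_ext)
  next
    fix \<pi> assume "\<pi> \<in> carrier (dual_module_with M dual_action)"
    then have \<pi>: "\<pi> \<in> dual_set M" by (simp add: dual_module_with_def)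
    have "\<one>\<^bsub>?D\<^esub> = diff_op l 1" by (simp add: fun_eq_iff)
    then show "\<one>\<^bsub>?D\<^esub> \<odot>\<^bsub>dual_module_with M dual_action\<^esub> \<pi> = \<pi>"
      using \<pi> by (simp add: dual_module_with_def dual_action_diff_op restrict_dual_set_id
          del: diff_op_ring_simps)
  qed
  fix \<pi> assume \<pi>: "\<pi> \<in> dual_set M"
  have "hbar_d l = diff_op l [:0, 1:]"
    by (simp add: fun_eq_iff op.ev_pCons)
  then have "dual_action (hbar_d l) \<pi> = restrict (contragredient \<pi>) (carrier M)"
    using dual_action_diff_op[OF \<pi>, of "[:0, 1:]"] by (simp add: contra.ev_pCons)
  then show "dual_action (hbar_d l) \<pi> =
      (\<lambda>X\<in>carrier M. - \<pi> (hbar_d l \<odot>\<^bsub>M\<^esub> X) + hbar * q_ddq l (\<pi> X))"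
    by (simp add: contragredient_def) (simp add: hbar_d_def)
  fix f
  have "mult_op f = diff_op l [:f:]"
    by (simp add: fun_eq_iff mult_op_def)
  then show "dual_action (mult_op f) \<pi> = (\<lambda>X\<in>carrier M. f * \<pi> X)"
    using dual_action_diff_op[OF \<pi>, of "[:f:]"]
    by simp (simp add: fun_scale_def)
qed

text \<open>
  Peeling off one factor \<open>\<hbar>\<partial>\<close> at a time, the action of an operator in normal form is forced by that
  of the generators.
\<close>

lemma is_dual_action_unique:
  assumes "is_dual_action l M act1" "is_dual_action l M act2"
  shows "act1 = act2"
proof (rule PiE_ext)
  show act: "act1 \<in> carrier (diff_op_ring l) \<rightarrow>\<^sub>E (dual_set M \<rightarrow>\<^sub>E dual_set M)"
    "act2 \<in> carrier (diff_op_ring l) \<rightarrow>\<^sub>E (dual_set M \<rightarrow>\<^sub>E dual_set M)"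
    using assms by (simp_all add: is_dual_action_def)
  have module: "left_module (diff_op_ring l) (dual_module_with M act1)"
    "left_module (diff_op_ring l) (dual_module_with M act2)"
    using assms by (simp_all add: is_dual_action_def)
  have gen: "act1 (mult_op f) \<pi> = act2 (mult_op f) \<pi>" "act1 (hbar_d l) \<pi> = act2 (hbar_d l) \<pi>"
    if "\<pi> \<in> dual_set M" for f \<pi>
    using assms that by (simp_all add: is_dual_action_def)
  fix P assume P: "P \<in> carrier (diff_op_ring l)"
  then obtain p where p: "P = diff_op l p" by (auto simp: carrier_diff_op_ring)
  have zero: "act1 (diff_op l 0) \<pi> = act2 (diff_op l 0) \<pi>" if "\<pi> \<in> dual_set M" for \<pi>
  proof -
    have "diff_op l 0 = mult_op 0"
      by (simp add: fun_eq_iff mult_op_def)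
    then show ?thesis using gen that by simp
  qed
  have "act1 (diff_op l p) \<pi> = act2 (diff_op l p) \<pi>" if "\<pi> \<in> dual_set M" for \<pi>
    using that
  proof (induction p arbitrary: \<pi>)
    case 0
    then show ?case by (rule zero)
  next
    case (pCons a p)
    have "act1 (hbar_d l) \<pi> \<in> dual_set M"
      using act(1) hbar_d_in_carrier[of l] pCons.prems by blast
    then show ?case
      using left_module_diff_op_pCons[OF module(1), of \<pi> a p]
        left_module_diff_op_pCons[OF module(2), of \<pi> a p] pCons gen[OF pCons.prems]
      by (simp add: dual_module_with_def)
  qed
  then show "act1 P = act2 P"
    using act P unfolding p by (intro PiE_ext[of _ "dual_set M" "\<lambda>_. dual_set M"]) auto
qed

lemma dual_module_eq: "dual_module l M = dual_module_with M dual_action"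
proof -
  have "(THE act. is_dual_action l M act) = dual_action"
    by (rule the_equality)
      (use is_dual_action_dual_action is_dual_action_unique in auto)
  then show ?thesis by (simp add: dual_module_def)
qed

abbreviation (input) N where "N \<equiv> sign_reversed_dual l M"

lemma sign_reversed_dual_simps:
  "carrier N = dual_set M" "\<zero>\<^bsub>N\<^esub> = (\<lambda>X\<in>carrier M. 0)"
  "\<pi> \<oplus>\<^bsub>N\<^esub> \<rho> = (\<lambda>X\<in>carrier M. \<pi> X + \<rho> X)"
  "P \<odot>\<^bsub>N\<^esub> \<pi> = dual_action (sign_reverse P) \<pi>"
  by (simp_all add: sign_reversed_dual_def dual_module_eq dual_module_with_def)

lemma sign_reverse_closed:
  "P \<in> carrier (diff_op_ring l) \<Longrightarrow> sign_reverse P \<in> carrier (diff_op_ring l)"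
proof -
  have "sign_reverse (diff_op l p) \<in> carrier (diff_op_ring l)" for p
  proof (induction p)
    case 0
    have "sign_reverse (diff_op l 0) = \<zero>\<^bsub>diff_op_ring l\<^esub>"
      by (simp add: fun_eq_iff sign_reverse_def D.sigma.zero)
    then show ?case by (simp only: R.zero_closed)
  next
    case (pCons a p)
    have "sign_reverse (diff_op l (pCons a p)) = mult_op (hbar_reflect a) \<oplus>\<^bsub>diff_op_ring l\<^esub>
        sign_reverse (diff_op l p) \<otimes>\<^bsub>diff_op_ring l\<^esub> (mult_op (- 1) \<otimes>\<^bsub>diff_op_ring l\<^esub> hbar_d l)"
      by (simp add: fun_eq_iff sign_reverse_def op.ev_pCons mult_op_def hbar_reflect_add
          hbar_reflect_mult hbar_reflect_uminus D.sigma_d)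
    then show ?case
      using pCons.IH by (simp only: R.a_closed R.m_closed mult_op_in_carrier hbar_d_in_carrier)
  qed
  then show "P \<in> carrier (diff_op_ring l) \<Longrightarrow> sign_reverse P \<in> carrier (diff_op_ring l)"
    by (auto simp: carrier_diff_op_ring)
qed

lemma sign_reversed_left_module: "left_module (diff_op_ring l) N"
proof -
  let ?D = "diff_op_ring l"
  interpret A: left_module ?D "dual_module_with M dual_action"
    using is_dual_action_dual_action by (simp add: is_dual_action_def)
  have N: "N = dual_module_with M (\<lambda>P. dual_action (sign_reverse P))"
    by (simp add: sign_reversed_dual_def dual_module_eq dual_module_with_def)
  interpret N: abelian_group N
    unfolding N by (rule dual_abelian_group)
  have add: "sign_reverse (P \<oplus>\<^bsub>?D\<^esub> Q) = sign_reverse P \<oplus>\<^bsub>?D\<^esub> sign_reverse Q"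
    and mult: "sign_reverse (P \<otimes>\<^bsub>?D\<^esub> Q) = sign_reverse P \<otimes>\<^bsub>?D\<^esub> sign_reverse Q"
    and one: "sign_reverse \<one>\<^bsub>?D\<^esub> = \<one>\<^bsub>?D\<^esub>" for P Q
    by (simp_all add: fun_eq_iff sign_reverse_def hbar_reflect_add)
  show ?thesis
    using A.smult_closed A.smult_l_distr A.smult_r_distr A.smult_assoc A.smult_one sign_reverse_closed
    by unfold_locales
      (simp_all add: N dual_module_with_def add mult one del: diff_op_ring_simps)
qed

lemma sign_reversed_mult_op:
  assumes "\<pi> \<in> dual_set M"
  shows "mult_op f \<odot>\<^bsub>N\<^esub> \<pi> = (\<lambda>X\<in>carrier M. hbar_reflect f * \<pi> X)"
  using is_dual_action_dual_action assms
  by (simp add: sign_reversed_dual_simps sign_reverse_mult_op is_dual_action_def)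

lemma sign_reversed_hbar_d:
  assumes "\<pi> \<in> dual_set M"
  shows "hbar_d l \<odot>\<^bsub>N\<^esub> \<pi> = (\<lambda>X\<in>carrier M. \<pi> (hbar_d l \<odot>\<^bsub>M\<^esub> X) - hbar_d l (\<pi> X))"
proof -
  have "sign_reverse (hbar_d l) = diff_op l [:0, - 1:]"
    by (simp add: fun_eq_iff sign_reverse_hbar_d op.ev_pCons)
  then have "hbar_d l \<odot>\<^bsub>N\<^esub> \<pi> = restrict (contra.ev [:0, - 1:] \<pi>) (carrier M)"
    using assms by (simp add: sign_reversed_dual_simps dual_action_diff_op)
  then show ?thesis
    by (auto simp: contra_ev_pCons_apply contragredient_def)
qed

end

section \<open>The dual of a cyclic quotient module\<close>

locale operator_quotient = dual_sequences "hbar_d l" t s Ci hbar_reflect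
  for l :: nat and t :: "coeff poly" and s Ci +
  assumes l_pos: "l > 0"
begin

notation star (infixl "\<star>" 70)

definition I :: "(coeff \<Rightarrow> coeff) set" where
  "I = left_ideal_gen (diff_op_ring l) (diff_op l t)"

lemma I_eq: "I = range (\<lambda>a. diff_op l (a \<star> t))"
  by (auto simp: I_def left_ideal_gen_def carrier_diff_op_ring diff_op_star)

lemma diff_op_in_I: "diff_op l p \<in> I \<longleftrightarrow> (\<exists>a. p = a \<star> t)"
  by (auto simp: I_eq diff_op_inj[OF l_pos])

sublocale ring "diff_op_ring l"
  by (rule diff_op_ring_ring)

lemma diff_op_closed [simp]: "diff_op l p \<in> carrier (diff_op_ring l)"
  by (simp add: carrier_diff_op_ring)

lemma diff_op_add: "diff_op l p \<oplus>\<^bsub>diff_op_ring l\<^esub> diff_op l r = diff_op l (p + r)"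
  by (simp add: fun_eq_iff op.ev_add)

lemma diff_op_mult: "diff_op l p \<otimes>\<^bsub>diff_op_ring l\<^esub> diff_op l r = diff_op l (p \<star> r)"
  by (simp add: diff_op_star)

lemma diff_op_uminus: "\<ominus>\<^bsub>diff_op_ring l\<^esub> diff_op l p = diff_op l (- p)"
proof (rule minus_equality)
  show "diff_op l (- p) \<oplus>\<^bsub>diff_op_ring l\<^esub> diff_op l p = \<zero>\<^bsub>diff_op_ring l\<^esub>"
    by (simp add: fun_eq_iff op.ev.minus)
qed simp_all

lemma diff_op_diff: "diff_op l p \<ominus>\<^bsub>diff_op_ring l\<^esub> diff_op l r = diff_op l (p - r)"
  by (simp only: a_minus_def diff_op_uminus diff_op_add diff_conv_add_uminus)

sublocale left_ideal I "diff_op_ring l"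
proof (intro left_ideal.intro left_ideal_axioms.intro additive_subgroup.intro)
  show "ring (diff_op_ring l)"
    by (rule diff_op_ring_ring)
  show "subgroup I (add_monoid (diff_op_ring l))"
  proof (rule add.subgroupI)
    show "I \<subseteq> carrier (diff_op_ring l)"
      by (auto simp: I_eq)
    show "I \<noteq> {}"
      by (auto simp: I_eq)
    show "\<ominus>\<^bsub>diff_op_ring l\<^esub> P \<in> I" if P: "P \<in> I" for P
    proof -
      obtain a where "P = diff_op l (a \<star> t)" using P by (auto simp: I_eq)
      then have "\<ominus>\<^bsub>diff_op_ring l\<^esub> P = diff_op l ((- a) \<star> t)"
        by (simp add: diff_op_uminus poly.ev.minus)
      then show ?thesis by (auto simp: I_eq)
    qed
    show "P \<oplus>\<^bsub>diff_op_ring l\<^esub> Q \<in> I" if PQ: "P \<in> I" "Q \<in> I" for P Q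
    proof -
      obtain a b where "P = diff_op l (a \<star> t)" "Q = diff_op l (b \<star> t)"
        using PQ by (auto simp: I_eq)
      then have "P \<oplus>\<^bsub>diff_op_ring l\<^esub> Q = diff_op l ((a + b) \<star> t)"
        by (simp only: diff_op_add poly.ev_add)
      then show ?thesis by (auto simp: I_eq)
    qed
  qed
  show "P \<otimes>\<^bsub>diff_op_ring l\<^esub> Q \<in> I" if PQ: "P \<in> carrier (diff_op_ring l)" "Q \<in> I" for P Q
  proof -
    obtain p a where "P = diff_op l p" "Q = diff_op l (a \<star> t)"
      using PQ by (auto simp: I_eq carrier_diff_op_ring)
    then have "P \<otimes>\<^bsub>diff_op_ring l\<^esub> Q = diff_op l ((p \<star> a) \<star> t)"
      by (simp only: diff_op_mult poly.ev_star)
    then show ?thesis by (auto simp: I_eq)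
  qed
qed

definition M :: "(coeff \<Rightarrow> coeff) set coeff_module" where
  "M = quot_module (diff_op_ring l) I"

definition coset_of :: "coeff poly \<Rightarrow> (coeff \<Rightarrow> coeff) set" where
  "coset_of p = I +>\<^bsub>diff_op_ring l\<^esub> diff_op l p"

lemma carrier_M: "carrier M = range coset_of"
  by (auto simp: M_def quot_carrier coset_of_def carrier_diff_op_ring)

lemma coset_of_in_carrier [simp]: "coset_of p \<in> carrier M"
  by (simp add: carrier_M)

lemma coset_of_add: "coset_of p \<oplus>\<^bsub>M\<^esub> coset_of r = coset_of (p + r)"
  by (simp add: M_def coset_of_def quot_add diff_op_add del: diff_op_ring_simps)

lemma coset_of_smult: "diff_op l p \<odot>\<^bsub>M\<^esub> coset_of r = coset_of (p \<star> r)"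
  by (simp add: M_def coset_of_def quot_smult diff_op_mult del: diff_op_ring_simps)

lemma coset_of_mult_op: "mult_op f \<odot>\<^bsub>M\<^esub> coset_of r = coset_of (smult f r)"
proof -
  have "mult_op f = diff_op l [:f:]"
    by (simp add: fun_eq_iff mult_op_def)
  then show ?thesis by (simp add: coset_of_smult)
qed

lemma coset_of_hbar_d: "hbar_d l \<odot>\<^bsub>M\<^esub> coset_of r = coset_of (shift r)"
proof -
  have "hbar_d l = diff_op l [:0, 1:]"
    by (simp add: fun_eq_iff op.ev_pCons)
  then show ?thesis using coset_of_smult[of "[:0, 1:]" r] by (simp add: poly.ev_pCons)
qed

lemma coset_of_eq_iff: "coset_of p = coset_of r \<longleftrightarrow> (\<exists>a. p - r = a \<star> t)"
  by (simp add: coset_of_def coset_eq_iff diff_op_diff diff_op_in_I)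

lemma coset_of_monom: "coset_of (monom 1 j) = I +>\<^bsub>diff_op_ring l\<^esub> (hbar_d l ^^ j)"
proof -
  have "diff_op l (monom 1 j) = hbar_d l ^^ j"
    by (simp add: fun_eq_iff op.ev_monom)
  then show ?thesis by (simp add: coset_of_def)
qed

sublocale diff_op_module l M
proof (intro diff_op_module.intro diff_op_module_axioms.intro l_pos)
  show "left_module (diff_op_ring l) M"
    unfolding M_def by (rule quot_left_module)
qed

text \<open>
  The sequence of a functional.  It intertwines the sign-reversed dual with the sequences
  (\<open>restriction_smult\<close>) and identifies the dual set with \<open>functionals\<close>.
\<close>

definition restriction :: "((coeff \<Rightarrow> coeff) set \<Rightarrow> coeff) \<Rightarrow> nat \<Rightarrow> coeff" where
  "restriction \<pi> = (\<lambda>k. \<pi> (coset_of (monom 1 k)))"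

lemma dual_set_coset_of:
  assumes "\<pi> \<in> dual_set M"
  shows "\<pi> (coset_of p) = pairing (restriction \<pi>) p"
proof -
  have add: "\<pi> (coset_of (p + r)) = \<pi> (coset_of p) + \<pi> (coset_of r)" for p r
    using assms by (simp add: dual_set_def flip: coset_of_add)
  have smult: "\<pi> (coset_of (smult f p)) = f * \<pi> (coset_of p)" for f p
    using assms by (simp add: dual_set_def flip: coset_of_mult_op)
  interpret additive "\<lambda>p. \<pi> (coset_of p)"
    by standard (rule add)
  have "\<pi> (coset_of p) = \<pi> (coset_of (\<Sum>i\<le>degree p. smult (coeff p i) (monom 1 i)))"
    by (simp add: smult_monom poly_as_sum_of_monoms)
  also have "\<dots> = pairing (restriction \<pi>) p"
    by (simp only: sum smult pairing_def restriction_def)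
  finally show ?thesis .
qed

lemma restriction_functional: "\<pi> \<in> dual_set M \<Longrightarrow> restriction \<pi> \<in> functionals"
proof -
  assume \<pi>: "\<pi> \<in> dual_set M"
  have "pairing (restriction \<pi>) (a \<star> t) = 0" for a
  proof -
    have "coset_of (a \<star> t) = coset_of 0"
      unfolding coset_of_eq_iff by auto
    then show ?thesis
      using dual_set_coset_of[OF \<pi>, of 0] dual_set_coset_of[OF \<pi>, of "a \<star> t"] by (simp add: pairing.zero)
  qed
  then show ?thesis by (simp add: functionals_def)
qed

lemma restriction_inj:
  assumes "\<pi> \<in> dual_set M" "\<rho> \<in> dual_set M" "restriction \<pi> = restriction \<rho>"
  shows "\<pi> = \<rho>"
proof (rule extensionalityI)
  show "\<pi> \<in> extensional (carrier M)" "\<rho> \<in> extensional (carrier M)"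
    using assms by (simp_all add: dual_set_def)
  fix X assume "X \<in> carrier M"
  then obtain p where "X = coset_of p" by (auto simp: carrier_M)
  then show "\<pi> X = \<rho> X"
    using assms by (simp add: dual_set_coset_of)
qed

lemma restriction_surj:
  assumes "\<psi> \<in> functionals"
  shows "\<exists>\<pi>\<in>dual_set M. restriction \<pi> = \<psi>"
proof -
  \<comment> \<open>the choice of representative is harmless because \<open>\<psi>\<close> vanishes on the ideal\<close>
  define \<pi> where "\<pi> = (\<lambda>X\<in>carrier M. pairing \<psi> (SOME p. X = coset_of p))"
  have \<pi>: "\<pi> (coset_of p) = pairing \<psi> p" for p
  proof -
    have "coset_of p = coset_of (SOME r. coset_of p = coset_of r)"
      by (rule someI) (rule refl)
    then obtain a where "p - (SOME r. coset_of p = coset_of r) = a \<star> t"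
      unfolding coset_of_eq_iff by blast
    then have "pairing \<psi> (p - (SOME r. coset_of p = coset_of r)) = 0"
      using assms by (simp add: functionals_def)
    then show ?thesis
      by (simp add: \<pi>_def pairing.diff)
  qed
  have "\<pi> \<in> dual_set M"
    by (auto simp: dual_set_def carrier_M coset_of_add coset_of_mult_op \<pi> pairing_add pairing_smult)
      (simp add: \<pi>_def carrier_M)
  moreover have "restriction \<pi> = \<psi>"
    by (simp add: restriction_def \<pi>)
  ultimately show ?thesis by blast
qed

lemma smult_dual_closed:
  "P \<in> carrier (diff_op_ring l) \<Longrightarrow> \<pi> \<in> dual_set M \<Longrightarrow> P \<odot>\<^bsub>N\<^esub> \<pi> \<in> dual_set M"
  using left_module.smult_closed[OF sign_reversed_left_module]
  by (simp only: sign_reversed_dual_simps(1))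

lemma restriction_smult:
  assumes "\<pi> \<in> dual_set M"
  shows "restriction (diff_op l p \<odot>\<^bsub>N\<^esub> \<pi>) = seq.ev p (restriction \<pi>)"
  using assms
proof (induction p arbitrary: \<pi>)
  case 0
  have "diff_op l 0 = mult_op 0"
    by (simp add: fun_eq_iff mult_op_def)
  moreover have "restriction (mult_op 0 \<odot>\<^bsub>N\<^esub> \<pi>) = 0"
    using 0 by (simp add: sign_reversed_mult_op restriction_def fun_eq_iff sigma.zero)
  ultimately show ?case
    by (simp only: seq.ev_0)
next
  case (pCons a p)
  have mult: "restriction (mult_op a \<odot>\<^bsub>N\<^esub> \<pi>) = seq_scale a (restriction \<pi>)"
    using pCons.prems by (simp add: sign_reversed_mult_op restriction_def seq_scale_def fun_eq_iff)
  have "const_coeffs (monom 1 k)" for k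
    by (simp add: const_coeffs_def)
  then have "restriction (hbar_d l \<odot>\<^bsub>N\<^esub> \<pi>) = seq_shift (restriction \<pi>)"
    using pCons.prems by (simp add: sign_reversed_hbar_d restriction_def seq_shift_def fun_eq_iff
        coset_of_hbar_d shift_const monom_Suc)
  then have "restriction (diff_op l p \<odot>\<^bsub>N\<^esub> (hbar_d l \<odot>\<^bsub>N\<^esub> \<pi>)) =
      seq.ev p (seq_shift (restriction \<pi>))"
    using pCons.prems by (simp only: pCons.IH smult_dual_closed hbar_d_in_carrier)
  moreover have "restriction (\<rho> \<oplus>\<^bsub>N\<^esub> \<rho>') = restriction \<rho> + restriction \<rho>'" for \<rho> \<rho>'
    by (simp add: sign_reversed_dual_simps(3) restriction_def fun_eq_iff)
  ultimately show ?case
    using pCons.prems mult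
    by (subst left_module_diff_op_pCons[OF sign_reversed_left_module])
      (simp_all only: sign_reversed_dual_simps(1) seq.ev_pCons)
qed

lemma dual_basis_restriction:
  assumes "i < s"
  defines "\<delta> \<equiv> dual_basis M s (\<lambda>j. coset_of (monom 1 j)) i"
  shows "\<delta> \<in> dual_set M" and "restriction \<delta> = dual_seq i"
proof -
  let ?P = "\<lambda>\<pi>. \<pi> \<in> dual_set M \<and> (\<forall>j<s. \<pi> (coset_of (monom 1 j)) = (if j = i then 1 else 0))"
  obtain \<pi> where \<pi>: "\<pi> \<in> dual_set M" "restriction \<pi> = dual_seq i"
    using restriction_surj[OF dual_seq_functional] by blast
  have "?P \<pi>"
    using \<pi> by (simp add: fun_eq_iff restriction_def dual_seq_less)
  moreover have "\<rho> = \<pi>" if "?P \<rho>" for \<rho>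
  proof (rule restriction_inj)
    show "restriction \<rho> = restriction \<pi>"
    proof (rule functionals_eqI)
      show "restriction \<rho> \<in> functionals" "restriction \<pi> \<in> functionals"
        using that \<pi> by (simp_all add: restriction_functional dual_seq_functional)
      show "restriction \<rho> j = restriction \<pi> j" if "j < s" for j
        using that \<open>?P \<rho>\<close> \<open>?P \<pi>\<close> by (simp add: restriction_def)
    qed
  qed (use that \<pi> in auto)
  ultimately have "\<delta> = \<pi>"
    unfolding \<delta>_def dual_basis_def by (rule the_equality)
  with \<pi> show "\<delta> \<in> dual_set M" and "restriction \<delta> = dual_seq i"
    by simp_all
qed

lemma restriction_eq_0_iff:
  assumes "\<pi> \<in> dual_set M"
  shows "restriction \<pi> = 0 \<longleftrightarrow> \<pi> = \<zero>\<^bsub>N\<^esub>"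
proof -
  have zero: "restriction \<zero>\<^bsub>N\<^esub> = 0"
    by (simp add: sign_reversed_dual_simps(2) restriction_def fun_eq_iff)
  interpret N: left_module "diff_op_ring l" N
    by (rule sign_reversed_left_module)
  have "\<zero>\<^bsub>N\<^esub> \<in> dual_set M"
    using N.M.zero_closed by (simp only: sign_reversed_dual_simps(1))
  then show ?thesis
    using restriction_inj[OF assms] zero by auto
qed

end

section \<open>Self-duality\<close>

locale self_dual_operator =
  reflection_symmetric_operator "hbar_d l" hbar_reflect h q qi C Ci P n r
  for l :: nat and h q qi C Ci P n r +
  assumes l_pos: "l > 0"
begin

sublocale operator_quotient l t s Ci
  by (intro operator_quotient.intro operator_quotient_axioms.intro l_pos) (rule dual_sequences_axioms)

notation star (infixl "\<star>" 70)

theorem self_duality: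
  fixes \<delta>
  defines "\<delta> \<equiv> dual_basis M s (\<lambda>j. coset_of (monom 1 j)) n"
  shows "{P \<odot>\<^bsub>N\<^esub> \<delta> | P. P \<in> carrier (diff_op_ring l)} = carrier N \<and>
    diff_op l t \<odot>\<^bsub>N\<^esub> \<delta> = \<zero>\<^bsub>N\<^esub> \<and>
    (\<exists>\<Phi>. (\<forall>P\<in>carrier (diff_op_ring l). \<Phi> (I +>\<^bsub>diff_op_ring l\<^esub> P) = P \<odot>\<^bsub>N\<^esub> \<delta>) \<and>
      left_module_iso (diff_op_ring l) M N \<Phi>)"
proof (intro conjI)
  have "n < s" by (simp add: s_def)
  note \<delta> = dual_basis_restriction[OF this, folded \<delta>_def]
  have ev: "restriction (diff_op l p \<odot>\<^bsub>N\<^esub> \<delta>) = seq.ev p (dual_seq n)" for p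
    using restriction_smult[OF \<delta>(1)] \<delta>(2) by simp
  have closed: "diff_op l p \<odot>\<^bsub>N\<^esub> \<delta> \<in> dual_set M" for p
    using \<delta>(1) by (intro smult_dual_closed) simp_all
  have ann: "diff_op l p \<odot>\<^bsub>N\<^esub> \<delta> = \<zero>\<^bsub>N\<^esub> \<longleftrightarrow> (\<exists>a. p = a \<star> t)" for p
    unfolding restriction_eq_0_iff[OF closed, symmetric] ev by (rule dual_seq_annihilator)
  show cyclic: "{P \<odot>\<^bsub>N\<^esub> \<delta> | P. P \<in> carrier (diff_op_ring l)} = carrier N"
  proof (intro equalityI subsetI)
    fix \<pi> assume "\<pi> \<in> carrier N"
    then have \<pi>: "\<pi> \<in> dual_set M" by (simp only: sign_reversed_dual_simps(1))
    then obtain p where "restriction \<pi> = seq.ev p (dual_seq n)"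
      using dual_seq_cyclic restriction_functional by blast
    then have "\<pi> = diff_op l p \<odot>\<^bsub>N\<^esub> \<delta>"
      using restriction_inj[OF \<pi> closed] ev by simp
    then show "\<pi> \<in> {P \<odot>\<^bsub>N\<^esub> \<delta> | P. P \<in> carrier (diff_op_ring l)}"
      using diff_op_closed by blast
  next
    fix \<pi> assume "\<pi> \<in> {P \<odot>\<^bsub>N\<^esub> \<delta> | P. P \<in> carrier (diff_op_ring l)}"
    then obtain p where "\<pi> = diff_op l p \<odot>\<^bsub>N\<^esub> \<delta>"
      by (auto simp: carrier_diff_op_ring)
    then show "\<pi> \<in> carrier N"
      using closed by (simp only: sign_reversed_dual_simps(1))
  qed
  show "diff_op l t \<odot>\<^bsub>N\<^esub> \<delta> = \<zero>\<^bsub>N\<^esub>"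
    unfolding restriction_eq_0_iff[OF closed, symmetric] ev by (rule annihilates_dual_seq)
  show "\<exists>\<Phi>. (\<forall>P\<in>carrier (diff_op_ring l). \<Phi> (I +>\<^bsub>diff_op_ring l\<^esub> P) = P \<odot>\<^bsub>N\<^esub> \<delta>) \<and>
      left_module_iso (diff_op_ring l) M N \<Phi>"
  proof (rule cyclic_left_module_iso[folded M_def])
    show "left_module (diff_op_ring l) N"
      by (rule sign_reversed_left_module)
    show "\<delta> \<in> carrier N"
      using \<delta>(1) by (simp only: sign_reversed_dual_simps(1))
    show "carrier N = {P \<odot>\<^bsub>N\<^esub> \<delta> | P. P \<in> carrier (diff_op_ring l)}"
      using cyclic by (rule sym)
    show "P \<odot>\<^bsub>N\<^esub> \<delta> = \<zero>\<^bsub>N\<^esub> \<longleftrightarrow> P \<in> I" if "P \<in> carrier (diff_op_ring l)" for P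
      using that by (auto simp: carrier_diff_op_ring ann diff_op_in_I)
  qed
qed

end

section \<open>The hypergeometric operator\<close>

lemma degree_prod_le_sum:
  fixes f :: "'b \<Rightarrow> 'a::comm_ring_1 poly"
  assumes "finite A" "\<And>i. i \<in> A \<Longrightarrow> degree (f i) \<le> e i"
  shows "degree (prod f A) \<le> sum e A"
    and "coeff (prod f A) (sum e A) = (\<Prod>i\<in>A. coeff (f i) (e i))"
proof -
  have top: "coeff (p * r) (a + b) = coeff p a * coeff r b"
    if "degree p \<le> a" "degree r \<le> b" for p r :: "'a poly" and a b
  proof -
    have "coeff p i * coeff r (a + b - i) = (if i = a then coeff p a * coeff r b else 0)" for i
    proof (cases i a rule: linorder_cases)
      case less
      then have "a + b - i > degree r" using that(2) by linarith
      with less show ?thesis by (simp add: coeff_eq_0)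
    next
      case greater
      then have "i > degree p" using that(1) by linarith
      with greater show ?thesis by (simp add: coeff_eq_0)
    qed simp
    then show ?thesis
      by (simp add: coeff_mult)
  qed
  have "degree (prod f A) \<le> sum e A \<and> coeff (prod f A) (sum e A) = (\<Prod>i\<in>A. coeff (f i) (e i))"
    using assms
  proof (induction A)
    case (insert i A)
    then have IH: "degree (prod f A) \<le> sum e A" "degree (f i) \<le> e i"
      "coeff (prod f A) (sum e A) = (\<Prod>i\<in>A. coeff (f i) (e i))"
      by auto
    then show ?case
      using insert.hyps top[OF IH(2,1)] degree_mult_le[of "f i" "prod f A"] by auto
  qed simp
  then show "degree (prod f A) \<le> sum e A"
    and "coeff (prod f A) (sum e A) = (\<Prod>i\<in>A. coeff (f i) (e i))"
    by blast+
qed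

context derivation
begin

lemma d_of_nat [simp]: "d (of_nat k) = 0"
  by (induction k) (simp_all add: d_add)

lemma const_coeffs_smult: "d a = 0 \<Longrightarrow> const_coeffs p \<Longrightarrow> const_coeffs (smult a p)"
  by (simp add: const_coeffs_def d_mult)

lemma const_coeffs_prod: "(\<And>i. i \<in> A \<Longrightarrow> const_coeffs (f i)) \<Longrightarrow> const_coeffs (prod f A)"
  by (induction A rule: infinite_finite_induct) (simp_all add: const_coeffs_mult)

end

context derivation_involution
begin

lemma sigma_of_nat [simp]: "\<sigma> (of_nat k) = of_nat k"
  by (induction k) (simp_all add: sigma_add sigma.zero)

lemma map_poly_sigma_mult: "map_poly \<sigma> (p * r) = map_poly \<sigma> p * map_poly \<sigma> r"
  by (rule poly_eqI) (simp add: coeff_map_poly sigma.zero coeff_mult sigma.sum sigma_mult)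

lemma map_poly_sigma_smult: "map_poly \<sigma> (smult a p) = smult (\<sigma> a) (map_poly \<sigma> p)"
  by (rule poly_eqI) (simp add: coeff_map_poly sigma.zero sigma_mult)

lemma map_poly_sigma_prod: "map_poly \<sigma> (prod f A) = (\<Prod>i\<in>A. map_poly \<sigma> (f i))"
  by (induction A rule: infinite_finite_induct)
    (simp_all add: map_poly_sigma_mult map_poly_1')

end

definition factor_poly :: "nat \<Rightarrow> nat \<Rightarrow> coeff poly" where
  "factor_poly m k = [:- (of_nat k * hbar), of_nat m:]"

lemma hbar_d_hbar: "hbar_d l hbar = 0"
  by (simp add: hbar_def hbar_d_single)

lemma const_coeffs_factor_poly: "D.const_coeffs l (factor_poly m k)"
  by (simp add: factor_poly_def D.minus D.d_mult hbar_d_hbar)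

lemma diff_op_factor_poly: "diff_op l (factor_poly m k) = T_factor l m k"
  by (simp add: fun_eq_iff factor_poly_def op.ev_pCons T_factor_def)

lemma foldr_comp_diff_op:
  assumes "\<forall>p\<in>set ps. D.const_coeffs l p"
  shows "foldr (\<circ>) (map (diff_op l) ps) id = diff_op l (prod_list ps)"
    and "D.const_coeffs l (prod_list ps)"
proof -
  have "foldr (\<circ>) (map (diff_op l) ps) id = diff_op l (prod_list ps) \<and> D.const_coeffs l (prod_list ps)"
    using assms
    by (induction ps) (simp_all add: fun_eq_iff op.ev_mult_const D.const_coeffs_mult)
  then show "foldr (\<circ>) (map (diff_op l) ps) id = diff_op l (prod_list ps)"
    and "D.const_coeffs l (prod_list ps)"
    by blast+
qed

text \<open>
  The product of the factors belonging to one weight \<open>m\<close>, with \<open>X\<close> removed from the factor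
  \<open>m X\<close>; the product over all weights is \<open>P\<close>.
\<close>

definition reduced_poly :: "nat \<Rightarrow> coeff poly" where
  "reduced_poly m = smult (of_nat m) (\<Prod>k\<in>{1..<m}. factor_poly m k)"

lemma prod_factor_poly:
  assumes "m > 0"
  shows "prod_list (map (factor_poly m) [0..<m]) = monom 1 1 * reduced_poly m"
proof -
  have "prod_list (map (factor_poly m) [0..<m]) = prod (factor_poly m) {0..<m}"
    by (simp flip: prod.distinct_set_conv_list)
  also have "\<dots> = factor_poly m 0 * prod (factor_poly m) {1..<m}"
    using assms by (simp add: prod.atLeast_Suc_lessThan)
  also have "factor_poly m 0 = smult (of_nat m) (monom 1 1)"
    by (simp add: factor_poly_def monom_Suc monom_0 smult_monom)
  finally show ?thesis
    by (simp add: reduced_poly_def)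
qed

lemma prod_list_concat: "prod_list (concat xss) = prod_list (map prod_list xss)"
  by (induction xss) simp_all

lemma T_op_eq:
  assumes "\<forall>i\<le>n. w i > 0"
  shows "T_op l n w = diff_op l ((\<Prod>i\<le>n. reduced_poly (w i)) * monom 1 (Suc n))"
proof -
  define ps where "ps = concat (map (\<lambda>i. map (factor_poly (w i)) [0..<w i]) [0..<Suc n])"
  have "T_factor l m = diff_op l \<circ> factor_poly m" for m
    by (simp add: fun_eq_iff[of "T_factor l m"] diff_op_factor_poly)
  then have "T_op l n w = foldr (\<circ>) (map (diff_op l) ps) id"
    by (simp add: T_op_def ps_def map_concat o_def del: upt_Suc)
  also have "\<dots> = diff_op l (prod_list ps)"
    by (rule foldr_comp_diff_op) (auto simp: ps_def const_coeffs_factor_poly)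
  also have "prod_list ps = prod_list (map (\<lambda>i. monom 1 1 * reduced_poly (w i)) [0..<Suc n])"
  proof -
    have "prod_list ps = prod_list (map (\<lambda>i. prod_list (map (factor_poly (w i)) [0..<w i])) [0..<Suc n])"
      by (simp only: ps_def prod_list_concat map_map o_def)
    also have "\<dots> = prod_list (map (\<lambda>i. monom 1 1 * reduced_poly (w i)) [0..<Suc n])"
      using assms by (intro arg_cong[of _ _ prod_list] map_cong) (auto simp: prod_factor_poly)
    finally show ?thesis .
  qed
  also have "\<dots> = (\<Prod>i\<le>n. monom 1 1 * reduced_poly (w i))"
    by (subst prod.distinct_set_conv_list[symmetric])
      (simp_all add: atLeast0LessThan lessThan_Suc_atMost del: upt_Suc)
  also have "\<dots> = (\<Prod>i\<le>n. reduced_poly (w i)) * monom 1 (Suc n)"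
    by (simp add: prod.distrib monom_power mult_monom mult.commute)
  finally show ?thesis .
qed

lemma reduced_poly_const: "D.const_coeffs l (reduced_poly m)"
  unfolding reduced_poly_def
  by (intro D.const_coeffs_smult D.const_coeffs_prod const_coeffs_factor_poly D.d_of_nat)

lemma reduced_poly_top:
  assumes "m > 0"
  shows "degree (reduced_poly m) \<le> m - 1"
    and "coeff (reduced_poly m) (m - 1) = of_nat m ^ m"
proof -
  have deg: "degree (factor_poly m k) \<le> 1" and top: "coeff (factor_poly m k) 1 = of_nat m" for k
    by (simp_all add: factor_poly_def)
  have sum: "(\<Sum>k\<in>{1..<m}. 1) = m - 1"
    by simp
  have "degree (\<Prod>k\<in>{1..<m}. factor_poly m k) \<le> m - 1"
    using degree_prod_le_sum(1)[of "{1..<m}" "factor_poly m" "\<lambda>_. 1"] deg by (simp only: sum finite_atLeastLessThan)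
  then show "degree (reduced_poly m) \<le> m - 1"
    unfolding reduced_poly_def using degree_smult_le order_trans by blast
  have "coeff (\<Prod>k\<in>{1..<m}. factor_poly m k) (m - 1) = of_nat m ^ (m - 1)"
    using degree_prod_le_sum(2)[of "{1..<m}" "factor_poly m" "\<lambda>_. 1"] deg top by simp
  then show "coeff (reduced_poly m) (m - 1) = of_nat m ^ m"
    using assms by (simp add: reduced_poly_def power_eq_if)
qed

text \<open>
  Substituting \<open>X + \<hbar>\<close> for \<open>X\<close> turns \<open>m X - k\<hbar>\<close> into \<open>m X + (m - k)\<hbar>\<close>, which is the reflection of the
  factor with index \<open>m - k\<close>.
\<close>

lemma reduced_poly_reflect:
  "reduced_poly m \<circ>\<^sub>p [:hbar, 1:] = map_poly hbar_reflect (reduced_poly m)"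
proof -
  \<comment> \<open>reindex the product by \<open>k \<mapsto> m - k\<close>\<close>
  have "(\<Prod>k\<in>{1..<m}. factor_poly m k \<circ>\<^sub>p [:hbar, 1:]) =
      (\<Prod>k\<in>{1..<m}. map_poly hbar_reflect (factor_poly m k))"
  proof (rule prod.reindex_bij_witness[of _ "\<lambda>k. m - k" "\<lambda>k. m - k"])
    fix k assume "k \<in> {1..<m}"
    then show "map_poly hbar_reflect (factor_poly m (m - k)) = factor_poly m k \<circ>\<^sub>p [:hbar, 1:]"
      by (simp add: factor_poly_def pcompose_pCons map_poly_pCons D.sigma.zero hbar_reflect_uminus
          D.sigma.diff hbar_reflect_mult hbar_reflect_hbar of_nat_diff algebra_simps)
  qed auto
  then show ?thesis
    by (simp add: reduced_poly_def pcompose_smult pcompose_prod D.map_poly_sigma_smult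
        D.map_poly_sigma_prod)
qed

lemma of_nat_unit:
  assumes "m > 0"
  shows "Poly_Mapping.single 0 (germ_const (1 / of_nat m)) * (of_nat m :: coeff) = 1"
proof -
  have "germ_const (of_nat m) = of_nat m"
    by (induction m) (simp_all add: germ_const_add)
  then have "germ_const (1 / of_nat m) * of_nat m = 1"
    using assms by (metis germ_const_1 germ_const_mult nonzero_eq_divide_eq not_gr_zero of_nat_eq_0_iff)
  then show ?thesis
    by (simp add: mult_single flip: single_of_nat single_one)
qed

theorem proposition4p1:
  fixes n l s :: nat and w :: "nat \<Rightarrow> nat"
  assumes w_pos: "\<forall>i\<le>n. w i > 0"
    and l_def: "l = Lcm (w ` {..n})"
    and s_def: "s = (\<Sum>i\<le>n. w i)"
    and D_def: "D = diff_op_ring l"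
    and I_def: "I = left_ideal_gen D (T_minus_q l n w)"
    and M_def: "M = quot_module D I"
    and N_def: "N = sign_reversed_dual l M"
    and \<delta>_def: "\<delta> = dual_basis M s (\<lambda>j. I +>\<^bsub>D\<^esub> (hbar_d l ^^ j))"
  shows "{P \<odot>\<^bsub>N\<^esub> \<delta> n |P. P \<in> carrier D} = carrier N \<and>
    T_minus_q l n w \<odot>\<^bsub>N\<^esub> \<delta> n = \<zero>\<^bsub>N\<^esub> \<and>
    (\<exists>\<Phi>. (\<forall>P\<in>carrier D. \<Phi> (I +>\<^bsub>D\<^esub> P) = P \<odot>\<^bsub>N\<^esub> \<delta> n) \<and> left_module_iso D M N \<Phi>)"
proof -
  have "0 \<notin> w ` {..n}"
    using w_pos by fastforce
  then have l_pos: "l > 0"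
    by (metis Lcm_0_iff finite_atMost finite_imageI l_def gr0I)
  define P where "P = (\<Prod>i\<le>n. reduced_poly (w i))"
  define r where "r = (\<Sum>i\<le>n. w i - 1)"
  define C :: coeff where "C = (\<Prod>i\<le>n. of_nat (w i) ^ w i)"
  define Ci :: coeff where
    "Ci = (\<Prod>i\<le>n. Poly_Mapping.single 0 (germ_const (1 / of_nat (w i))) ^ w i)"
  have top: "degree (reduced_poly (w i)) \<le> w i - 1"
    "coeff (reduced_poly (w i)) (w i - 1) = of_nat (w i) ^ w i" if "i \<le> n" for i
    using w_pos that by (simp_all only: reduced_poly_top)
  interpret T: self_dual_operator l hbar "qvar l" "Poly_Mapping.single (- int l) 1" C Ci P n r
  proof
    show "hbar_d l hbar = 0"
      by (rule hbar_d_hbar)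
    show "hbar_d l (qvar l) = hbar * qvar l"
      using l_pos by (simp add: qvar_def hbar_d_single hbar_def mult_single)
    show "Poly_Mapping.single (- int l) 1 * qvar l = 1"
      by (simp add: qvar_def mult_single)
    show "hbar_reflect (qvar l) = qvar l"
      by (simp add: qvar_def hbar_reflect_single)
    show "Ci * C = 1"
      using w_pos by (simp add: C_def Ci_def of_nat_unit flip: prod.distrib power_mult_distrib)
    show "hbar_reflect C = C"
      by (simp add: C_def flip: of_nat_power of_nat_prod)
    show "D.const_coeffs l P"
      unfolding P_def by (intro D.const_coeffs_prod reduced_poly_const)
    show "degree P \<le> r" "coeff P r = C"
      unfolding P_def r_def C_def
      using top degree_prod_le_sum[of "{..n}" "\<lambda>i. reduced_poly (w i)" "\<lambda>i. w i - 1"]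
      by simp_all
    show "P \<circ>\<^sub>p [:hbar, 1:] = map_poly hbar_reflect P"
      by (simp add: P_def pcompose_prod D.map_poly_sigma_prod reduced_poly_reflect)
  qed (rule l_pos)
  have "s = (\<Sum>i\<le>n. Suc (w i - 1))"
    unfolding s_def using w_pos by (intro sum.cong) auto
  also have "\<dots> = Suc (n + r)"
    by (simp add: r_def sum_Suc)
  finally have s: "T.s = s"
    by (simp only: T.s_def)
  have t: "T_minus_q l n w = diff_op l T.t"
    by (simp add: fun_eq_iff T_minus_q_def T_op_eq[OF w_pos, folded P_def] T.t_def op.ev.diff)
  have I: "I = T.I"
    by (simp add: I_def D_def t T.I_def)
  have M: "M = T.M"
    by (simp add: M_def D_def I T.M_def)
  have \<delta>: "\<delta> = dual_basis T.M T.s (\<lambda>j. T.coset_of (monom 1 j))"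
    by (simp only: \<delta>_def M s I D_def T.coset_of_monom)
  show ?thesis
    unfolding N_def \<delta> t I M D_def by (rule T.self_duality)
qed

end
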